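(* The unit sphere of $\mathcal{C}([0,1])$ is approximately indivisible.
   Context: $\mathcal{C}([0,1])$ is the Banach space of continuous real-valued functions on $[0,1]$ with the supremum norm; its unit sphere is viewed as a metric space with the distance induced by the norm. For a metric space $X$, $Y\subset X$ and $\varepsilon>0$, let $(Y)_\varepsilon=\{x\in X:\exists y\in Y\ d(x,y)\leqslant\varepsilon\}$. $X$ is $\varepsilon$-indivisible when for every integer $k\geqslant1$ and every $\chi:X\to\{0,\dots,k-1\}$ there are $i<k$ and a subspace $\widetilde X\subset X$ isometric to $X$ (as a metric space) with $\widetilde X\subset(\chi^{-1}(\{i\}))_\varepsilon$. $X$ is approximately indivisible when it is $\varepsilon$-indivisible for every $\varepsilon>0$. *)

theory Defs
  imports "HOL-Analysis.Analysis"
begin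

text \<open>The interval $[0,1]$ as a type, so that \<^typ>\<open>'a \<Rightarrow>\<^sub>C 'b\<close> gives the Banach space
  of continuous functions on it with the supremum norm.\<close>

typedef unit_interval = "{0..1::real}"
  by (rule exI[of _ 0]) simp

instantiation unit_interval :: metric_space
begin

definition dist_unit_interval :: "unit_interval \<Rightarrow> unit_interval \<Rightarrow> real"
  where "dist_unit_interval s t = \<bar>Rep_unit_interval s - Rep_unit_interval t\<bar>"

definition uniformity_unit_interval :: "(unit_interval \<times> unit_interval) filter"
  where "uniformity_unit_interval = (INF e\<in>{0 <..}. principal {(x, y). dist x y < e})"

definition open_unit_interval :: "unit_interval set \<Rightarrow> bool"
  where "open_unit_interval U = (\<forall>x\<in>U. \<forall>\<^sub>F (x', y) in uniformity. x' = x \<longrightarrow> y \<in> U)"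

instance
proof
  fix x y z :: unit_interval
  show "dist x y = 0 \<longleftrightarrow> x = y"
    by (simp add: dist_unit_interval_def Rep_unit_interval_inject)
  show "dist x y \<le> dist x z + dist y z"
    by (simp add: dist_unit_interval_def)
qed (rule uniformity_unit_interval_def open_unit_interval_def)+

end

lemma continuous_on_Abs_unit_interval: "continuous_on {0..1} Abs_unit_interval"
  unfolding continuous_on_iff
  by (auto simp: dist_unit_interval_def dist_real_def Abs_unit_interval_inverse)

lemma compact_UNIV_unit_interval: "compact (UNIV :: unit_interval set)"
proof -
  have "UNIV = Abs_unit_interval ` {0..1}"
    by (metis Rep_unit_interval Rep_unit_interval_inverse UNIV_eq_I image_eqI)
  then show ?thesis
    by (metis compact_Icc compact_continuous_image continuous_on_Abs_unit_interval)
qed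

text \<open>Boundedness is automatic, and continuity means continuity on $[0,1]$ as a subset of the
  real line.\<close>

lemma bcontfun_unit_interval_iff:
  fixes f :: "unit_interval \<Rightarrow> real"
  shows "f \<in> bcontfun \<longleftrightarrow> continuous_on UNIV f"
  unfolding bcontfun_def
  using compact_UNIV_unit_interval compact_continuous_image compact_imp_bounded by blast

lemma continuous_on_unit_interval_iff:
  fixes f :: "unit_interval \<Rightarrow> real"
  shows "continuous_on UNIV f \<longleftrightarrow> continuous_on {0..1} (\<lambda>t. f (Abs_unit_interval t))"
proof
  assume "continuous_on UNIV f"
  then show "continuous_on {0..1} (\<lambda>t. f (Abs_unit_interval t))"
    using continuous_on_Abs_unit_interval continuous_on_compose2 by blast
next
  assume f: "continuous_on {0..1} (\<lambda>t. f (Abs_unit_interval t))"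
  have "continuous_on UNIV Rep_unit_interval"
    unfolding continuous_on_iff by (auto simp: dist_unit_interval_def dist_real_def)
  moreover have "range Rep_unit_interval \<subseteq> {0..1}"
    using Rep_unit_interval by blast
  ultimately have "continuous_on UNIV (\<lambda>t. f (Abs_unit_interval (Rep_unit_interval t)))"
    by (rule continuous_on_compose2[OF f])
  then show "continuous_on UNIV f"
    by (simp add: Rep_unit_interval_inverse)
qed

type_synonym C01 = "unit_interval \<Rightarrow>\<^sub>C real"

text \<open>A metric space is represented as a subset of a metric type, with the induced distance.\<close>

definition closed_fattening :: "'a::metric_space set \<Rightarrow> 'a set \<Rightarrow> real \<Rightarrow> 'a set"
  where "closed_fattening X Y \<epsilon> = {x \<in> X. \<exists>y\<in>Y. dist x y \<le> \<epsilon>}"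

definition isometric :: "'a::metric_space set \<Rightarrow> 'b::metric_space set \<Rightarrow> bool"
  where "isometric X Y \<longleftrightarrow>
    (\<exists>\<phi>. bij_betw \<phi> X Y \<and> (\<forall>x\<in>X. \<forall>x'\<in>X. dist (\<phi> x) (\<phi> x') = dist x x'))"

definition eps_indivisible :: "real \<Rightarrow> 'a::metric_space set \<Rightarrow> bool"
  where "eps_indivisible \<epsilon> X \<longleftrightarrow>
    (\<forall>k\<ge>(1::nat). \<forall>c \<in> X \<rightarrow> {..<k}.
      \<exists>i<k. \<exists>X'\<subseteq>X. isometric X' X \<and> X' \<subseteq> closed_fattening X {x \<in> X. c x = i} \<epsilon>)"

definition approx_indivisible :: "'a::metric_space set \<Rightarrow> bool"
  where "approx_indivisible X \<longleftrightarrow> (\<forall>\<epsilon>>0. eps_indivisible \<epsilon> X)"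

end

theory Submission
  imports Defs
begin

text \<open>Take the cost \<open>word_cost a b\<close>, the supremum of the differences of letters at common indices, on finite words with letters
  in $[0,2]$, and replace it by the path metric that it generates. The path metric still agrees with
  the cost on pairs of words whose letters satisfy the triangle inequality
  \<open>word_cost a b \<le> a\<^sub>l + b\<^sub>l\<close>, and every countable metric space of diameter at most 2 embeds in the unit
  sphere of $C([0,1])$. So a colouring of the sphere induces one of the words over a fine grid
  \<open>{0, \<eta>, \<dots>, m\<eta> = 2}\<close>.

  By a version of Gowers' theorem for words (proved with an idempotent ultrafilter that absorbs all
  its shifts) there are words $b_0, b_1, \dots$ containing 0 such that all concatenations
  $T^{j_0} b_0 \cdots T^{j_{n-1}} b_{n-1} b_n$ have one colour, where $T^j$ raises all letters by
  $j$ steps, cut off at $m$. Let $x_0, x_1, \dots$ be dense in the sphere. Raising the blocks of the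
  $n$-th word by the exact distances $d(x_n, x_l)$ instead of grid distances gives words that form an
  isometric copy of $(x_n)$, and each of them is within \<open>\<eta>\<close> of a grid word of the chosen colour.
  The isometry extends to the closure of $(x_n)$.\<close>

subsection \<open>Ultrafilters on words\<close>

text \<open>Ultrafilters are taken inside the type of filters, ordered by reverse inclusion, so
  \<open>u \<le> principal A\<close> says that \<open>A\<close> belongs to \<open>u\<close>.\<close>

definition ultra :: "'a filter \<Rightarrow> bool"
  where "ultra u \<longleftrightarrow> u \<noteq> bot \<and> (\<forall>P. eventually P u \<or> eventually (\<lambda>x. \<not> P x) u)"

text \<open>On ultrafilters this is the extension of concatenation to the Stone-Cech
  compactification of the words, continuous in the left factor. If
  \<open>F \<star> F \<le> F\<close>, the ultrafilters finer than \<open>F\<close> form a closed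
  subsemigroup.\<close>

definition filter_conv :: "'a list filter \<Rightarrow> 'a list filter \<Rightarrow> 'a list filter" (infixr "\<star>" 70)
  where "F \<star> G = Abs_filter (\<lambda>P. \<forall>\<^sub>F x in F. \<forall>\<^sub>F y in G. P (x @ y))"

lemma eventually_filter_conv:
  "eventually P (F \<star> G) \<longleftrightarrow> (\<forall>\<^sub>F x in F. \<forall>\<^sub>F y in G. P (x @ y))"
  unfolding filter_conv_def
proof (rule eventually_Abs_filter, rule is_filter.intro)
  fix P Q :: "'a list \<Rightarrow> bool"
  assume "\<forall>\<^sub>F x in F. \<forall>\<^sub>F y in G. P (x @ y)" "\<forall>\<^sub>F x in F. \<forall>\<^sub>F y in G. Q (x @ y)"
  then show "\<forall>\<^sub>F x in F. \<forall>\<^sub>F y in G. P (x @ y) \<and> Q (x @ y)"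
    by (simp add: eventually_conj_iff)
next
  fix P Q :: "'a list \<Rightarrow> bool"
  assume PQ: "\<forall>x. P x \<longrightarrow> Q x" and "\<forall>\<^sub>F x in F. \<forall>\<^sub>F y in G. P (x @ y)"
  show "\<forall>\<^sub>F x in F. \<forall>\<^sub>F y in G. Q (x @ y)"
    by (rule eventually_mono[OF \<open>\<forall>\<^sub>F x in F. _ x\<close>]) (use PQ in \<open>auto elim: eventually_mono\<close>)
qed simp

lemma filter_conv_assoc: "(F \<star> G) \<star> H = F \<star> (G \<star> H)"
  by (rule filter_eqI) (simp add: eventually_filter_conv)

lemma filter_conv_mono: "F \<le> F' \<Longrightarrow> G \<le> G' \<Longrightarrow> F \<star> G \<le> F' \<star> G'"
  unfolding le_filter_def eventually_filter_conv
  by (meson eventually_mono)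

lemma filter_conv_eq_bot_iff: "F \<star> G = bot \<longleftrightarrow> F = bot \<or> G = bot"
  unfolding eventually_False[symmetric, of "F \<star> G"] eventually_filter_conv
  by (auto simp: eventually_const_iff)

lemma filtermap_filter_conv:
  assumes "\<And>x y. f (x @ y) = f x @ f y"
  shows "filtermap f (F \<star> G) = filtermap f F \<star> filtermap f G"
  by (rule filter_eqI) (simp add: eventually_filter_conv eventually_filtermap assms)

lemma ultraD: "ultra u \<Longrightarrow> \<not> eventually P u \<Longrightarrow> eventually (\<lambda>x. \<not> P x) u"
  unfolding ultra_def by blast

lemma ultra_not_bot: "ultra u \<Longrightarrow> u \<noteq> bot"
  unfolding ultra_def by blast

text \<open>Turns inequalities obtained from monotonicity of \<open>\<star>\<close> into
  equations.\<close>

lemma ultra_minimal: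
  assumes "ultra u" "F \<le> u" "F \<noteq> bot"
  shows "F = u"
proof (rule antisym)
  show "u \<le> F"
  proof (rule filter_leI)
    fix P assume P: "eventually P F"
    show "eventually P u"
    proof (rule ccontr)
      assume "\<not> eventually P u"
      then have "eventually (\<lambda>x. \<not> P x) F"
        using assms ultraD filter_leD by blast
      with P have "eventually (\<lambda>x. False) F" by eventually_elim simp
      with assms(3) show False by simp
    qed
  qed
qed fact

lemma ultra_filter_conv: "ultra u \<Longrightarrow> ultra w \<Longrightarrow> ultra (u \<star> w)"
proof -
  assume u: "ultra u" and w: "ultra w"
  have "eventually P (u \<star> w) \<or> eventually (\<lambda>x. \<not> P x) (u \<star> w)" for P
  proof (rule disjCI)
    assume "\<not> eventually (\<lambda>x. \<not> P x) (u \<star> w)"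
    then have "\<forall>\<^sub>F x in u. \<not> (\<forall>\<^sub>F y in w. \<not> P (x @ y))"
      unfolding eventually_filter_conv by (rule ultraD[OF u])
    then show "eventually P (u \<star> w)"
      unfolding eventually_filter_conv by eventually_elim (use ultraD[OF w] in force)
  qed
  then show ?thesis using u w by (simp add: ultra_def filter_conv_eq_bot_iff)
qed

text \<open>Zorn's lemma in the role of compactness: the infimum of a chain of proper filters is
  proper, because each of its events is already an event of a member. A trivial \<open>Q\<close>
  yields ultrafilters, the condition \<open>G \<star> G \<le> G\<close> yields minimal
  subsemigroups.\<close>

lemma minimal_proper_filter:
  fixes F0 :: "'a filter"
  assumes F0: "Q F0" "F0 \<noteq> bot"
    and chain: "\<And>C. C \<noteq> {} \<Longrightarrow> (\<And>F. F \<in> C \<Longrightarrow> Q F) \<Longrightarrow> Q (Inf C)"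
  obtains F where "Q F" "F \<noteq> bot" "F \<le> F0" "\<And>G. Q G \<Longrightarrow> G \<noteq> bot \<Longrightarrow> G \<le> F \<Longrightarrow> G = F"
proof -
  define A where "A = {F. Q F \<and> F \<noteq> bot \<and> F \<le> F0}"
  have "\<exists>m\<in>A. \<forall>a\<in>A. a \<le> m \<longrightarrow> a = m"
  proof (rule predicate_Zorn[where P = "\<lambda>F G. G \<le> F"])
    show "partial_order_on A (relation_of (\<lambda>F G. G \<le> F) A)"
      by (rule partial_order_on_relation_ofI) auto
    fix C assume C: "C \<in> Chains (relation_of (\<lambda>F G. G \<le> F) A)"
    have CA: "C \<subseteq> A" using C by (auto simp: Chains_def relation_of_def)
    have lin: "F \<le> G \<or> G \<le> F" if "F \<in> C" "G \<in> C" for F G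
      using C that by (auto simp: Chains_def relation_of_def)
    show "\<exists>u\<in>A. \<forall>a\<in>C. u \<le> a"
    proof (cases "C = {}")
      case True
      then show ?thesis using F0 by (auto simp: A_def)
    next
      case False
      have "Inf C \<noteq> bot"
      proof
        assume "Inf C = bot"
        then have "eventually (\<lambda>x. False) (Inf C)" by simp
        also have "eventually (\<lambda>x. False) (Inf C) \<longleftrightarrow> (\<exists>F\<in>C. eventually (\<lambda>x. False) F)"
        proof (rule eventually_Inf_base[OF False])
          fix F G assume "F \<in> C" "G \<in> C"
          with lin[OF this] show "\<exists>H\<in>C. H \<le> inf F G"
            using \<open>F \<in> C\<close> \<open>G \<in> C\<close> by (auto intro: bexI[of _ F] bexI[of _ G])
        qed
        finally obtain F where "F \<in> C" "F = bot" by (auto simp: eventually_False)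
        with CA show False by (auto simp: A_def)
      qed
      moreover have "Q (Inf C)" using chain False CA by (auto simp: A_def)
      moreover obtain F where "F \<in> C" using False by blast
      then have "Inf C \<le> F0" using CA by (intro Inf_lower2[of F]) (auto simp: A_def)
      ultimately show ?thesis by (intro bexI[of _ "Inf C"]) (auto simp: A_def Inf_lower)
    qed
  qed
  then obtain M where "M \<in> A" and M: "\<And>G. G \<in> A \<Longrightarrow> G \<le> M \<Longrightarrow> G = M" by blast
  moreover have "G \<in> A" if "Q G" "G \<noteq> bot" "G \<le> M" for G
    using \<open>M \<in> A\<close> that unfolding A_def by (auto intro: order_trans)
  ultimately show thesis using that[of M] by (auto simp: A_def)
qed

lemma ultra_exists:
  assumes "F \<noteq> bot"
  obtains u where "ultra u" "u \<le> F"
proof -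
  obtain u where u: "u \<noteq> bot" "u \<le> F" "\<And>G. G \<noteq> bot \<Longrightarrow> G \<le> u \<Longrightarrow> G = u"
    using minimal_proper_filter[of "\<lambda>_. True" F] assms by auto
  have "eventually P u \<or> eventually (\<lambda>x. \<not> P x) u" for P
  proof (cases "inf u (principal {x. P x}) = bot")
    case True
    then have "eventually (\<lambda>x. False) (inf u (principal {x. P x}))" by simp
    then show ?thesis by (simp add: eventually_inf_principal)
  next
    case False
    then have "inf u (principal {x. P x}) = u" using u(3) by simp
    then have "u \<le> principal {x. P x}" by (metis inf.cobounded2)
    then show ?thesis by (simp add: le_principal)
  qed
  with u show thesis using that by (auto simp: ultra_def)
qed

text \<open>A filter stands for the closed set of all finer ultrafilters. In these terms right translation
  by \<open>u\<close> is a closed map: a point \<open>w\<close> of the image of \<open>F\<close> has a nonempty closed fibre \<open>H\<close>.\<close>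

lemma right_translate_preimage:
  fixes F u w :: "'a list filter"
  assumes "ultra u" "ultra w" "w \<le> F \<star> u"
  obtains H where "H \<noteq> bot" "H \<star> u \<le> w" "H \<le> F"
    "\<And>G. G \<le> F \<Longrightarrow> G \<star> u \<le> w \<Longrightarrow> G \<le> H"
proof -
  \<comment> \<open>\<open>H\<close> is generated by \<open>F\<close> and, for each event
    \<open>P\<close> of \<open>w\<close>, the set of those \<open>x\<close> for which
    \<open>x @ y\<close> satisfies \<open>P\<close> for \<open>u\<close>-almost all
    \<open>y\<close>.\<close>
  define H where "H = inf F (INF P\<in>{P. eventually P w}. principal {x. \<forall>\<^sub>F y in u. P (x @ y)})"
  have ev: "eventually S H \<longleftrightarrow>
      (\<exists>P. eventually P w \<and> (\<forall>\<^sub>F x in F. (\<forall>\<^sub>F y in u. P (x @ y)) \<longrightarrow> S x))" for S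
  proof -
    have base: "eventually R (INF P\<in>{P. eventually P w}. principal {x. \<forall>\<^sub>F y in u. P (x @ y)}) \<longleftrightarrow>
      (\<exists>P. eventually P w \<and> (\<forall>x. (\<forall>\<^sub>F y in u. P (x @ y)) \<longrightarrow> R x))" for R
    proof (subst eventually_INF_base)
      fix P Q assume "P \<in> {P. eventually P w}" "Q \<in> {P. eventually P w}"
      then show "\<exists>R\<in>{P. eventually P w}. principal {x. \<forall>\<^sub>F y in u. R (x @ y)} \<le>
        inf (principal {x. \<forall>\<^sub>F y in u. P (x @ y)}) (principal {x. \<forall>\<^sub>F y in u. Q (x @ y)})"
        by (intro bexI[of _ "\<lambda>z. P z \<and> Q z"]) (auto simp: eventually_conj_iff)
    next
      show "{P. eventually P w} \<noteq> {}" using eventually_True[of w] by blast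
    qed (simp add: eventually_principal)
    show ?thesis
    proof
      assume "eventually S H"
      then obtain Q P where "eventually Q F" and P: "eventually P w"
        and "\<And>x. Q x \<Longrightarrow> \<forall>\<^sub>F y in u. P (x @ y) \<Longrightarrow> S x"
        unfolding H_def eventually_inf base by blast
      then have "\<forall>\<^sub>F x in F. (\<forall>\<^sub>F y in u. P (x @ y)) \<longrightarrow> S x" by (auto elim!: eventually_mono)
      with P show "\<exists>P. eventually P w \<and> (\<forall>\<^sub>F x in F. (\<forall>\<^sub>F y in u. P (x @ y)) \<longrightarrow> S x)" by blast
    next
      assume "\<exists>P. eventually P w \<and> (\<forall>\<^sub>F x in F. (\<forall>\<^sub>F y in u. P (x @ y)) \<longrightarrow> S x)"
      then obtain P where P: "eventually P w" "\<forall>\<^sub>F x in F. (\<forall>\<^sub>F y in u. P (x @ y)) \<longrightarrow> S x" by blast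
      show "eventually S H"
        unfolding H_def eventually_inf base
      proof (intro exI conjI)
        show "\<forall>\<^sub>F x in F. (\<forall>\<^sub>F y in u. P (x @ y)) \<longrightarrow> S x" by fact
        show "eventually P w" by fact
        show "\<forall>x. (\<forall>\<^sub>F y in u. P (x @ y)) \<longrightarrow> (\<forall>\<^sub>F y in u. P (x @ y))" by simp
      qed simp
    qed
  qed
  \<comment> \<open>An empty fibre would give an event \<open>P\<close> of \<open>w\<close> whose
    negation holds in \<open>F \<star> u\<close>, hence in \<open>w\<close>. The negation moves past
    the inner quantifier because \<open>u\<close> is an ultrafilter.\<close>
  have "H \<noteq> bot"
  proof
    assume "H = bot"
    then have "eventually (\<lambda>_. False) H" by simp
    then obtain P where P: "eventually P w" "\<forall>\<^sub>F x in F. \<not> (\<forall>\<^sub>F y in u. P (x @ y))"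
      unfolding ev by auto
    have "\<forall>\<^sub>F x in F. \<forall>\<^sub>F y in u. \<not> P (x @ y)"
      using P(2) by eventually_elim (rule ultraD[OF assms(1)])
    then have "eventually (\<lambda>z. \<not> P z) w"
      using assms(3) by (auto simp: le_filter_def eventually_filter_conv)
    with P(1) have "eventually (\<lambda>z. False) w" by eventually_elim simp
    with assms(2) show False by (simp add: ultra_def)
  qed
  moreover have "H \<star> u \<le> w"
    unfolding le_filter_def eventually_filter_conv ev by auto
  moreover have "H \<le> F" by (simp add: H_def)
  moreover have "G \<le> H" if "G \<le> F" "G \<star> u \<le> w" for G
  proof (rule filter_leI)
    fix S assume "eventually S H"
    then obtain P where P: "eventually P w" "\<forall>\<^sub>F x in F. (\<forall>\<^sub>F y in u. P (x @ y)) \<longrightarrow> S x"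
      unfolding ev by auto
    have "\<forall>\<^sub>F x in G. \<forall>\<^sub>F y in u. P (x @ y)"
      using P(1) that(2) by (auto simp: le_filter_def eventually_filter_conv)
    moreover have "\<forall>\<^sub>F x in G. (\<forall>\<^sub>F y in u. P (x @ y)) \<longrightarrow> S x"
      using P(2) that(1) filter_leD by blast
    ultimately show "eventually S G" by eventually_elim simp
  qed
  ultimately show thesis by (rule that)
qed

text \<open>This is the Ellis-Numakura lemma. Take a minimal \<open>M\<close> with
  \<open>M \<star> M \<le> M\<close> and an ultrafilter \<open>u \<le> M\<close>. Minimality gives
  \<open>M \<star> u = M\<close>, so \<open>u\<close> has a nonempty fibre under right translation
  by \<open>u\<close>; this fibre is a subsemigroup, hence all of \<open>M\<close>. Thus
  \<open>M = M \<star> u \<le> u\<close>.\<close>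

lemma idempotent_ultrafilter:
  assumes "F \<noteq> bot" "F \<star> F \<le> F"
  obtains u where "ultra u" "u \<le> F" "u \<star> u = u"
proof -
  obtain M where M: "M \<star> M \<le> M" "M \<noteq> bot" "M \<le> F"
    and min: "\<And>G. G \<star> G \<le> G \<Longrightarrow> G \<noteq> bot \<Longrightarrow> G \<le> M \<Longrightarrow> G = M"
  proof (rule minimal_proper_filter[of "\<lambda>G. G \<star> G \<le> G" F])
    fix C :: "'a list filter set" assume C: "\<And>F. F \<in> C \<Longrightarrow> F \<star> F \<le> F"
    show "Inf C \<star> Inf C \<le> Inf C"
      by (rule Inf_greatest) (rule order_trans[OF filter_conv_mono[OF Inf_lower Inf_lower] C])
  qed (use assms in auto)
  obtain u where u: "ultra u" "u \<le> M" using ultra_exists[OF M(2)] .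
  have Mu: "M \<star> u = M"
  proof (rule min)
    have "(M \<star> u) \<star> (M \<star> u) \<le> (M \<star> M) \<star> (M \<star> u)"
      using u by (intro filter_conv_mono) auto
    also have "\<dots> \<le> M \<star> (M \<star> u)" by (rule filter_conv_mono[OF M(1) order_refl])
    also have "\<dots> \<le> M \<star> u"
      unfolding filter_conv_assoc[symmetric] by (rule filter_conv_mono[OF M(1) order_refl])
    finally show "(M \<star> u) \<star> (M \<star> u) \<le> M \<star> u" .
    show "M \<star> u \<noteq> bot" using M u by (simp add: filter_conv_eq_bot_iff ultra_def)
    have "M \<star> u \<le> M \<star> M" by (intro filter_conv_mono u order_refl)
    then show "M \<star> u \<le> M" using M(1) by simp
  qed
  obtain H where H: "H \<noteq> bot" "H \<star> u \<le> u" "H \<le> M"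
    "\<And>G. G \<le> M \<Longrightarrow> G \<star> u \<le> u \<Longrightarrow> G \<le> H"
    using right_translate_preimage[OF u(1) u(1), of M] Mu u by metis
  have "H = M"
  proof (rule min)
    show "H \<star> H \<le> H"
    proof (rule H(4))
      show "H \<star> H \<le> M" by (rule order_trans[OF filter_conv_mono[OF H(3) H(3)] M(1)])
      show "(H \<star> H) \<star> u \<le> u"
        unfolding filter_conv_assoc
        by (rule order_trans[OF filter_conv_mono[OF order_refl H(2)] H(2)])
    qed
  qed (use H in auto)
  with H(2) Mu u(2) have "M = u" by simp
  then show thesis using that[of u] u M Mu by auto
qed

text \<open>With the letters replaced by \<open>m - e\<close>, \<open>raise m 1\<close> is the tetris operation of Gowers' theorem and
  \<open>rank_words m r\<close> consists of the words with maximum \<open>m - r\<close>.\<close>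

definition raise :: "nat \<Rightarrow> nat \<Rightarrow> nat list \<Rightarrow> nat list"
  where "raise m j = map (\<lambda>e. min (e + j) m)"

definition rank_words :: "nat \<Rightarrow> nat \<Rightarrow> nat list set"
  where "rank_words m r = {w. r \<in> set w \<and> set w \<subseteq> {r..m}}"

lemma raise_append: "raise m j (x @ y) = raise m j x @ raise m j y"
  by (simp add: raise_def)

lemma raise_raise: "raise m i (raise m j w) = raise m (i + j) w"
  by (auto simp: raise_def)

lemma raise_0: "set w \<subseteq> {..m} \<Longrightarrow> raise m 0 w = w"
  unfolding raise_def by (rule map_idI) auto

text \<open>Downward induction on \<open>r\<close>, starting from words with all letters
  \<open>m\<close>, which raising fixes. In the step, raising maps the new ultrafilter
  \<open>v\<close> to the old \<open>u\<close>, so the absorption laws become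
  \<open>u \<star> v = v\<close> and \<open>v \<star> u = v\<close>.\<close>

lemma raise_absorbing_ultrafilter:
  assumes "r \<le> m"
  shows "\<exists>u. ultra u \<and> u \<le> principal (rank_words m r) \<and> u \<star> u = u \<and>
    filtermap (raise m 1) u \<star> u = u \<and> u \<star> filtermap (raise m 1) u = u"
  using assms
proof (induction r rule: inc_induct)
  case base
  have "principal (rank_words m m) \<noteq> bot"
    by (auto simp: principal_eq_bot_iff rank_words_def intro!: exI[of _ "[m]"])
  moreover have "principal (rank_words m m) \<star> principal (rank_words m m) \<le> principal (rank_words m m)"
    by (auto simp: le_principal eventually_filter_conv eventually_principal rank_words_def)
  ultimately obtain u where u: "ultra u" "u \<le> principal (rank_words m m)" "u \<star> u = u"
    by (rule idempotent_ultrafilter)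
  have "\<forall>\<^sub>F w in u. raise m 1 w = w"
    using u(2) unfolding le_principal
    by eventually_elim (auto simp: rank_words_def raise_def intro!: map_idI)
  then have "(\<forall>\<^sub>F w in u. P (raise m 1 w)) \<longleftrightarrow> eventually P u" for P
    by (intro eventually_cong) (auto elim: eventually_mono)
  then have "filtermap (raise m 1) u = u"
    by (intro filter_eqI) (simp add: eventually_filtermap)
  with u show ?case by auto
next
  case (step r)
  define T where "T = filtermap (raise m 1)"
  have T_conv: "T (F \<star> G) = T F \<star> T G" for F G
    unfolding T_def by (rule filtermap_filter_conv) (rule raise_append)
  obtain u where u: "ultra u" "u \<le> principal (rank_words m (Suc r))" "u \<star> u = u"
    "T u \<star> u = u" "u \<star> T u = u"
    using step.IH unfolding T_def by blast
  \<comment> \<open>\<open>Q\<close> collects all candidates: the filters on words of rank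
    \<open>r\<close> that raising sends below \<open>u\<close>. It is proper since subtracting 1
    from all letters gives preimages of words of rank \<open>Suc r\<close>.\<close>
  define Q where "Q = inf (filtercomap (raise m 1) u) (principal (rank_words m r))"
  have le_Q: "G \<le> Q \<longleftrightarrow> T G \<le> u \<and> G \<le> principal (rank_words m r)" for G
    by (simp add: Q_def T_def filtermap_le_iff_le_filtercomap)
  have Q: "T Q \<le> u" "Q \<le> principal (rank_words m r)" using le_Q[of Q] by auto
  have "Q \<noteq> bot"
  proof
    assume "Q = bot"
    then have "eventually (\<lambda>_. False) Q" by simp
    then obtain P where P: "eventually P u" "\<And>x. P (raise m 1 x) \<Longrightarrow> x \<notin> rank_words m r"
      unfolding Q_def eventually_inf_principal eventually_filtercomap by blast
    have "eventually (\<lambda>w. P w \<and> w \<in> rank_words m (Suc r)) u"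
      using u(2) P(1) by (auto simp: le_principal eventually_conj_iff)
    then obtain w where w: "P w" "w \<in> rank_words m (Suc r)"
      using eventually_happens' ultra_not_bot[OF u(1)] by blast
    define v where "v = map (\<lambda>e. e - 1) w"
    have ge: "\<And>e. e \<in> set w \<Longrightarrow> Suc r \<le> e \<and> e \<le> m" using w(2) by (auto simp: rank_words_def)
    have "raise m 1 v = w"
      unfolding raise_def v_def map_map by (rule map_idI) (use ge in fastforce)
    moreover have "v \<in> rank_words m r"
      using ge w(2) unfolding rank_words_def v_def by (force simp: image_iff)
    ultimately show False using P(2) w(1) by auto
  qed
  \<comment> \<open>The laws for \<open>u\<close> collapse \<open>u \<star> T u \<star> u\<close> to
    \<open>u\<close>. The inclusion makes \<open>Q \<star> u\<close> a subsemigroup; an idempotent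
    is sought there because its elements absorb \<open>u\<close> on the right.\<close>
  have QuQ: "Q \<star> u \<star> Q \<le> Q"
    unfolding le_Q
  proof
    have "T (Q \<star> u \<star> Q) \<le> u \<star> T u \<star> u"
      unfolding T_conv by (rule filter_conv_mono[OF Q(1) filter_conv_mono[OF order_refl Q(1)]])
    then show "T (Q \<star> u \<star> Q) \<le> u" by (simp add: u)
    have "Q \<star> u \<star> Q \<le> principal (rank_words m r) \<star> principal (rank_words m (Suc r)) \<star> principal (rank_words m r)"
      by (rule filter_conv_mono[OF Q(2) filter_conv_mono[OF u(2) Q(2)]])
    also have "\<dots> \<le> principal (rank_words m r)"
      by (auto simp: le_principal eventually_filter_conv eventually_principal rank_words_def)
    finally show "Q \<star> u \<star> Q \<le> principal (rank_words m r)" .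
  qed
  have "Q \<star> u \<noteq> bot" using \<open>Q \<noteq> bot\<close> u(1) by (simp add: filter_conv_eq_bot_iff ultra_def)
  moreover have "(Q \<star> u) \<star> (Q \<star> u) \<le> Q \<star> u"
    using filter_conv_mono[OF QuQ order_refl[of u]] by (simp add: filter_conv_assoc)
  ultimately obtain w where w: "ultra w" "w \<le> Q \<star> u" "w \<star> w = w"
    by (rule idempotent_ultrafilter)
  obtain H where H: "H \<noteq> bot" "H \<star> u \<le> w" "H \<le> Q"
    using right_translate_preimage[OF u(1) w(1,2)] by blast
  \<comment> \<open>Being a translate by the idempotent \<open>u\<close>, \<open>w\<close> satisfies
    \<open>w \<star> u = w\<close>. Multiplying by \<open>u\<close> on the left makes
    \<open>v\<close> absorb \<open>u\<close> on both sides and keeps it idempotent.\<close>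
  have Hw: "H \<star> u = w"
    using H u(1) w(1) by (intro ultra_minimal) (auto simp: filter_conv_eq_bot_iff ultra_def)
  then have wu: "w \<star> u = w" using u(3) by (metis filter_conv_assoc)
  define v where "v = u \<star> w"
  have "v \<noteq> bot" using u(1) w(1) by (simp add: v_def filter_conv_eq_bot_iff ultra_def)
  have uv: "u \<star> v = v" unfolding v_def using u(3) by (metis filter_conv_assoc)
  have vu: "v \<star> u = v" unfolding v_def by (simp add: filter_conv_assoc wu)
  have "v \<star> v = (v \<star> u) \<star> w" by (simp add: v_def filter_conv_assoc)
  also have "\<dots> = v" by (simp add: vu) (simp add: v_def filter_conv_assoc w(3))
  finally have vv: "v \<star> v = v" .
  have "T H \<le> u" using filtermap_mono[OF H(3)] Q(1) unfolding T_def by (rule order_trans)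
  then have "T v \<le> T u \<star> (u \<star> T u)"
    unfolding v_def Hw[symmetric] T_conv by (intro filter_conv_mono order_refl)
  then have "T v \<le> u" by (simp add: u)
  then have Tv: "T v = u"
    using u(1) \<open>v \<noteq> bot\<close> by (intro ultra_minimal) (auto simp: T_def filtermap_bot_iff)
  have "v \<le> principal (rank_words m (Suc r)) \<star> principal (rank_words m r) \<star> principal (rank_words m (Suc r))"
    unfolding v_def Hw[symmetric]
    by (rule filter_conv_mono[OF u(2) filter_conv_mono[OF order_trans[OF H(3) Q(2)] u(2)]])
  also have "\<dots> \<le> principal (rank_words m r)"
    by (auto simp: le_principal eventually_filter_conv eventually_principal rank_words_def)
  finally have "v \<le> principal (rank_words m r)" .
  moreover have "ultra v" unfolding v_def by (rule ultra_filter_conv[OF u(1) w(1)])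
  ultimately show ?case using uv vu vv Tv unfolding T_def by (intro exI[of _ v]) simp
qed


section \<open>Monochromatic concatenations of raised blocks\<close>

lemma ultra_finite_colour:
  fixes c :: "'a \<Rightarrow> nat"
  assumes "ultra u" "eventually (\<lambda>w. c w < k) u"
  shows "\<exists>i<k. eventually (\<lambda>w. c w = i) u"
proof (rule ccontr)
  assume none: "\<not> ?thesis"
  have "\<forall>\<^sub>F w in u. c w \<noteq> i" if "i < k" for i
    using none that by (intro ultraD[OF assms(1)]) simp
  then have "\<forall>\<^sub>F w in u. \<forall>i\<in>{..<k}. c w \<noteq> i" by (intro eventually_ball_finite) auto
  with assms(2) have "\<forall>\<^sub>F w in u. False" by eventually_elim auto
  then show False using ultra_not_bot[OF assms(1)] by (simp add: eventually_False)
qed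

text \<open>Blocks are chosen one at a time, keeping finitely many good prefixes \<open>p\<close>,
  for which \<open>u\<close>-almost every \<open>w\<close> gives \<open>p @ w\<close> the colour
  \<open>i\<close>. As \<open>u\<close> equals \<open>filtermap (raise m j) u \<star> u\<close>,
  almost every \<open>x\<close> leaves all \<open>p @ raise m j x\<close> good, and goodness of
  \<open>p\<close> itself provides the final unraised block.\<close>

theorem raised_concat_monochromatic:
  fixes c :: "nat list \<Rightarrow> nat"
  assumes "\<And>w. w \<in> rank_words m 0 \<Longrightarrow> c w < k"
  shows "\<exists>i<k. \<exists>b. (\<forall>n. b n \<in> rank_words m 0) \<and>
    (\<forall>n j. (\<forall>l<n. j l \<le> m) \<longrightarrow> c (concat (map (\<lambda>l. raise m (j l) (b l)) [0..<n]) @ b n) = i)"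
proof -
  obtain u where u: "ultra u" "u \<le> principal (rank_words m 0)" "filtermap (raise m 1) u \<star> u = u" "u \<star> u = u"
    using raise_absorbing_ultrafilter[of 0 m] by blast
  have rank: "\<forall>\<^sub>F w in u. w \<in> rank_words m 0" using u(2) by (simp add: le_principal)
  have "\<forall>\<^sub>F w in u. c w < k" using rank by eventually_elim (rule assms)
  then obtain i where i: "i < k" "\<forall>\<^sub>F w in u. c w = i" using ultra_finite_colour[OF u(1), of c k] by blast
  \<comment> \<open>The induction step inserts \<open>filtermap (raise m 1) u \<star> u\<close> for
    \<open>u\<close> and pulls one raising out of the product of the first two factors.\<close>
  have absorb: "filtermap (raise m j) u \<star> u = u" for j
  proof (induction j)
    case 0
    have "\<forall>\<^sub>F w in u. raise m 0 w = w" using rank by eventually_elim (auto simp: rank_words_def atLeast0AtMost raise_0)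
    then have "(\<forall>\<^sub>F w in u. P (raise m 0 w)) \<longleftrightarrow> eventually P u" for P
      by (intro eventually_cong) (auto elim: eventually_mono)
    then have "filtermap (raise m 0) u = u" by (intro filter_eqI) (simp add: eventually_filtermap)
    then show ?case using u(4) by simp
  next
    case (Suc j)
    let ?T = "filtermap (raise m 1)"
    have T: "?T (filtermap (raise m j) u) = filtermap (raise m (Suc j)) u"
      by (simp add: filtermap_filtermap raise_raise)
    have "filtermap (raise m (Suc j)) u \<star> u = ?T (filtermap (raise m j) u) \<star> (?T u \<star> u)"
      unfolding T by (simp only: u(3))
    also have "\<dots> = ?T (filtermap (raise m j) u \<star> u) \<star> u"
      by (simp only: filtermap_filter_conv[OF raise_append] filter_conv_assoc)
    also have "\<dots> = u" by (simp only: Suc.IH u(3))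
    finally show ?case .
  qed
  define good where "good p \<longleftrightarrow> (\<forall>\<^sub>F w in u. c (p @ w) = i)" for p
  have step: "\<exists>x. x \<in> rank_words m 0 \<and> (\<forall>p\<in>P. c (p @ x) = i) \<and> (\<forall>p\<in>P. \<forall>j\<in>{..m}. good (p @ raise m j x))"
    if "finite P" "\<forall>p\<in>P. good p" for P
  proof -
    have "\<forall>\<^sub>F x in u. \<forall>p\<in>P. c (p @ x) = i"
      using that by (intro eventually_ball_finite) (auto simp: good_def)
    moreover have "\<forall>\<^sub>F x in u. \<forall>p\<in>P. \<forall>j\<in>{..m}. good (p @ raise m j x)"
    proof (intro eventually_ball_finite ballI that finite_atMost)
      fix p j assume pj: "p \<in> P" "j \<in> {..m}"
      then have "\<forall>\<^sub>F w in filtermap (raise m j) u \<star> u. c (p @ w) = i"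
        using that absorb by (simp add: good_def)
      then show "\<forall>\<^sub>F x in u. good (p @ raise m j x)"
        by (simp add: eventually_filter_conv eventually_filtermap good_def)
    qed
    ultimately have "\<forall>\<^sub>F x in u. x \<in> rank_words m 0 \<and> (\<forall>p\<in>P. c (p @ x) = i) \<and> (\<forall>p\<in>P. \<forall>j\<in>{..m}. good (p @ raise m j x))"
      using rank by eventually_elim auto
    then show ?thesis using eventually_happens' ultra_not_bot[OF u(1)] by blast
  qed
  \<comment> \<open>A state consists of the prefixes for all choices of exponents so far and the
    next block; thus one sequence of blocks serves every \<open>j\<close>.\<close>
  define ok where "ok n S \<longleftrightarrow> finite (fst S) \<and> (\<forall>p\<in>fst S. good p) \<and> (n = 0 \<longrightarrow> fst S = {[]}) \<and>
    snd S \<in> rank_words m 0 \<and> (\<forall>p\<in>fst S. c (p @ snd S) = i) \<and>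
    (\<forall>p\<in>fst S. \<forall>j\<in>{..m}. good (p @ raise m j (snd S)))" for n :: nat and S
  define nxt where "nxt S S' \<longleftrightarrow> fst S' = (\<lambda>(p, j). p @ raise m j (snd S)) ` (fst S \<times> {..m})" for S S' :: "nat list set \<times> nat list"
  have "\<exists>S. \<forall>n. ok n (S n) \<and> nxt (S n) (S (Suc n))"
  proof (rule dependent_nat_choice)
    show "\<exists>S. ok 0 S"
    proof -
      have "\<forall>p\<in>{[]}. good p" using i(2) by (simp add: good_def)
      from step[OF _ this] obtain x where "x \<in> rank_words m 0 \<and> (\<forall>p\<in>{[]}. c (p @ x) = i) \<and>
        (\<forall>p\<in>{[]}. \<forall>j\<in>{..m}. good (p @ raise m j x))" by blast
      then have "ok 0 ({[]}, x)" using i(2) by (simp add: ok_def good_def)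
      then show ?thesis by blast
    qed
    show "\<exists>S'. ok (Suc n) S' \<and> nxt S S'" if "ok n S" for n S
    proof -
      define P where "P = (\<lambda>(p, j). p @ raise m j (snd S)) ` (fst S \<times> {..m})"
      have "finite P" "\<forall>p\<in>P. good p" using that by (auto simp: ok_def P_def)
      from step[OF this] obtain x where "x \<in> rank_words m 0 \<and> (\<forall>p\<in>P. c (p @ x) = i) \<and>
        (\<forall>p\<in>P. \<forall>j\<in>{..m}. good (p @ raise m j x))" by blast
      with \<open>finite P\<close> \<open>\<forall>p\<in>P. good p\<close> have "ok (Suc n) (P, x)" by (simp add: ok_def)
      then show ?thesis by (intro exI[of _ "(P, x)"]) (simp add: nxt_def P_def)
    qed
  qed
  then obtain S where S: "\<And>n. ok n (S n)" "\<And>n. nxt (S n) (S (Suc n))" by blast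
  have pre: "concat (map (\<lambda>l. raise m (j l) (snd (S l))) [0..<n]) \<in> fst (S n)"
    if "\<And>l. l < n \<Longrightarrow> j l \<le> m" for n j
    using that
  proof (induction n)
    case 0
    show ?case using S(1)[of 0] by (simp add: ok_def)
  next
    case (Suc n)
    then have "concat (map (\<lambda>l. raise m (j l) (snd (S l))) [0..<n]) \<in> fst (S n)" "j n \<le> m" by auto
    then show ?case using S(2)[of n] unfolding nxt_def by (auto intro!: image_eqI[of _ _ "(_, j n)"])
  qed
  show ?thesis
  proof (intro exI[of _ i] exI[of _ "\<lambda>n. snd (S n)"] conjI allI impI)
    show "c (concat (map (\<lambda>l. raise m (j l) (snd (S l))) [0..<n]) @ snd (S n)) = i"
      if "\<forall>l<n. j l \<le> m" for n j
      using pre[of n j] that S(1)[of n] by (auto simp: ok_def)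
    show "i < k" by fact
    show "snd (S n) \<in> rank_words m 0" for n using S(1)[of n] by (simp add: ok_def)
  qed
qed

subsection \<open>Countable metric spaces in the sphere of $C([0,1])$\<close>

definition wave :: "real \<Rightarrow> real"
  where "wave t = max 0 (min 1 (1 / 2 - cos (pi * t)))"

lemma continuous_on_wave [continuous_intros]:
  fixes S :: "'a::t2_space set"
  shows "continuous_on S f \<Longrightarrow> continuous_on S (\<lambda>t. wave (f t))"
  unfolding wave_def by (intro continuous_intros)

lemma wave_bounds: "0 \<le> wave t" "wave t \<le> 1"
  by (auto simp: wave_def)

lemma wave_shift: "wave (2 * real n + t) = wave t"
proof -
  have "cos (pi * (2 * real n + t)) = cos (2 * real n * pi + pi * t)" by (simp add: algebra_simps)
  also have "\<dots> = cos (pi * t)" unfolding cos_add by simp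
  finally show ?thesis by (simp add: wave_def)
qed

lemma cos_ge_half: "0 \<le> t \<Longrightarrow> t \<le> 1 / 3 \<Longrightarrow> cos (pi * t) \<ge> 1 / 2"
  using cos_monotone_0_pi_le[of "pi * t" "pi / 3"] by (simp add: cos_60)

lemma wave_eq_0: "0 \<le> t \<Longrightarrow> t \<le> 1 / 3 \<Longrightarrow> wave t = 0"
  using cos_ge_half[of t] by (simp add: wave_def)

lemma wave_eq_1:
  assumes "2 / 3 \<le> t" "t \<le> 1"
  shows "wave t = 1"
proof -
  have "cos (pi * t) = - cos (pi * (1 - t))"
    by (simp add: algebra_simps cos_diff)
  then show ?thesis using cos_ge_half[of "1 - t"] assms by (simp add: wave_def)
qed

definition cantor_point :: "(nat \<Rightarrow> bool) \<Rightarrow> real"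
  where "cantor_point b = (\<Sum>i. 2 * of_bool (b i) / 3 ^ Suc i)"

lemma summable_cantor: "summable (\<lambda>i. 2 * of_bool (b i) / 3 ^ Suc i :: real)"
proof (rule summable_comparison_test')
  show "summable (\<lambda>i. 2 / 3 * (1 / 3) ^ i :: real)" by (intro summable_mult summable_geometric) simp
qed (auto simp: power_divide field_simps)

lemma cantor_point_bounds: "cantor_point b \<in> {0..1}"
proof -
  have "cantor_point b \<le> (\<Sum>i. 2 / 3 * (1 / 3) ^ i)"
    unfolding cantor_point_def
    by (intro suminf_le summable_cantor summable_mult summable_geometric) (auto simp: power_divide)
  also have "\<dots> = 2 / 3 * (\<Sum>i. (1 / 3 :: real) ^ i)"
    by (intro suminf_mult summable_geometric) simp
  also have "\<dots> = 1" by (subst suminf_geometric) auto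
  finally have "cantor_point b \<le> 1" .
  moreover have "0 \<le> cantor_point b"
    unfolding cantor_point_def by (intro suminf_nonneg summable_cantor) simp
  ultimately show ?thesis by simp
qed

lemma cantor_point_shift: "3 * cantor_point b = 2 * of_bool (b 0) + cantor_point (\<lambda>i. b (Suc i))"
proof -
  have "cantor_point (\<lambda>i. b (Suc i)) = (\<Sum>i. 3 * (2 * of_bool (b (Suc i)) / 3 ^ Suc (Suc i)))"
    by (simp add: cantor_point_def)
  also have "\<dots> = 3 * (\<Sum>i. 2 * of_bool (b (Suc i)) / 3 ^ Suc (Suc i))"
    using summable_cantor[of b] by (intro suminf_mult) (subst summable_Suc_iff)
  also have "(\<Sum>i. 2 * of_bool (b (Suc i)) / 3 ^ Suc (Suc i)) = cantor_point b - 2 * of_bool (b 0) / 3"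
    unfolding cantor_point_def using suminf_split_head[OF summable_cantor[of b]] by simp
  finally show ?thesis by (simp add: algebra_simps)
qed

lemma cantor_point_power: "\<exists>N. 3 ^ k * cantor_point b = 2 * real N + cantor_point (\<lambda>i. b (i + k))"
proof (induction k arbitrary: b)
  case 0
  show ?case by (intro exI[of _ 0]) simp
next
  case (Suc k)
  obtain N where N: "3 ^ k * cantor_point (\<lambda>i. b (Suc i)) = 2 * real N + cantor_point (\<lambda>i. b (Suc (i + k)))"
    using Suc.IH[of "\<lambda>i. b (Suc i)"] by auto
  have "3 ^ Suc k * cantor_point b = 3 ^ k * (3 * cantor_point b)" by simp
  also have "\<dots> = 2 * real (3 ^ k * of_bool (b 0) + N) + cantor_point (\<lambda>i. b (Suc (i + k)))"
    unfolding cantor_point_shift distrib_left N by simp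
  finally show ?case by (intro exI[of _ "3 ^ k * of_bool (b 0) + N"]) simp
qed

text \<open>Multiplication by \<open>3 ^ k\<close> brings digit \<open>k\<close> to the front up to
  an even integer, which the period 2 of \<open>wave\<close> ignores. What remains lies in $[0,1/3]$
  or $[2/3,1]$ according to this digit, and there \<open>wave\<close> is 0 or 1.\<close>

lemma wave_cantor_point: "wave (3 ^ k * cantor_point b) = of_bool (b k)"
proof -
  obtain N where N: "3 ^ k * cantor_point b = 2 * real N + cantor_point (\<lambda>i. b (i + k))"
    using cantor_point_power by blast
  have "wave (cantor_point (\<lambda>i. b (i + k))) = of_bool (b k)"
    using cantor_point_shift[of "\<lambda>i. b (i + k)"] cantor_point_bounds[of "\<lambda>i. b (Suc i + k)"]
    by (cases "b k") (auto intro!: wave_eq_0 wave_eq_1)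
  then show ?thesis unfolding N wave_shift .
qed

lemma binary_expansion:
  fixes s :: real
  assumes "s \<in> {0..1}"
  obtains b where "(\<lambda>i. (1 / 2) ^ Suc i * of_bool (b i)) sums s"
proof -
  \<comment> \<open>The orbit of \<open>s\<close> under the doubling map; \<open>x n\<close> is the
    remainder after \<open>n\<close> binary digits, rescaled to $[0,1]$. For \<open>s = 1\<close>
    all digits are 1.\<close>
  define x where "x n = ((\<lambda>x. 2 * x - of_bool (x \<ge> 1 / 2)) ^^ n) s" for n
  define b where "b n \<longleftrightarrow> x n \<ge> 1 / 2" for n
  have x_Suc: "x (Suc n) = 2 * x n - of_bool (b n)" for n by (simp add: x_def b_def)
  have x: "x n \<in> {0..1}" for n
  proof (induction n)
    case (Suc n)
    then show ?case unfolding x_Suc by (auto simp: b_def)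
  qed (use assms in \<open>simp add: x_def\<close>)
  have partial: "(\<Sum>i<n. (1 / 2) ^ Suc i * of_bool (b i)) = s - x n * (1 / 2) ^ n" for n
  proof (induction n)
    case (Suc n)
    then show ?case by (cases "b n") (simp_all add: x_Suc field_simps)
  qed (simp add: x_def)
  have "(\<lambda>n. x n * (1 / 2) ^ n) \<longlonglongrightarrow> 0"
  proof (rule tendsto_sandwich[of "\<lambda>_. 0"])
    show "(\<lambda>n. (1 / 2 :: real) ^ n) \<longlonglongrightarrow> 0" by (intro LIMSEQ_power_zero) simp
  qed (use x in \<open>auto intro!: always_eventually mult_left_le_one_le\<close>)
  then have "(\<lambda>n. s - x n * (1 / 2) ^ n) \<longlonglongrightarrow> s - 0" by (intro tendsto_intros)
  then have "(\<lambda>i. (1 / 2) ^ Suc i * of_bool (b i)) sums s"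
    unfolding sums_def partial by simp
  then show thesis by (rule that)
qed

text \<open>Coordinate \<open>n\<close> of the curve: its \<open>j\<close>-th binary digit is read
  from ternary position \<open>prod_encode (n, j)\<close> when \<open>t\<close> is a Cantor
  point.\<close>

definition schoenberg :: "nat \<Rightarrow> real \<Rightarrow> real"
  where "schoenberg n t = (\<Sum>j. (1 / 2) ^ Suc j * wave (3 ^ prod_encode (n, j) * t))"

lemma continuous_on_schoenberg: "continuous_on S (schoenberg n)"
proof -
  have "uniform_limit S (\<lambda>N t. \<Sum>j<N. (1 / 2) ^ Suc j * wave (3 ^ prod_encode (n, j) * t))
      (schoenberg n) sequentially"
    unfolding schoenberg_def
  proof (rule Weierstrass_m_test)
    show "summable (\<lambda>j. (1 / 2 :: real) ^ Suc j)"
      by (subst summable_Suc_iff) (simp add: summable_geometric)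
  qed (simp add: wave_bounds abs_mult)
  then show ?thesis
    by (rule uniform_limit_theorem[rotated])
      (auto intro!: always_eventually continuous_intros)
qed

text \<open>The binary digits of all \<open>s n\<close> are interleaved into the digits of a single
  Cantor point.\<close>

lemma schoenberg_surjective:
  assumes "\<And>n. s n \<in> {0..1}"
  shows "\<exists>t\<in>{0..1}. \<forall>n. schoenberg n t = s n"
proof -
  have "\<exists>b. (\<lambda>i. (1 / 2) ^ Suc i * of_bool (b i)) sums s n" for n
    using binary_expansion[OF assms[of n]] by metis
  then obtain b where b: "\<And>n. (\<lambda>i. (1 / 2) ^ Suc i * of_bool (b n i)) sums s n" by metis
  define t where "t = cantor_point (\<lambda>k. case prod_decode k of (n, i) \<Rightarrow> b n i)"
  have "schoenberg n t = s n" for n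
    unfolding schoenberg_def t_def wave_cantor_point prod_encode_inverse prod.case
    using b[of n] by (simp add: sums_iff)
  then show ?thesis using cantor_point_bounds unfolding t_def by blast
qed

text \<open>Coordinates are treated in order: \<open>s n\<close> is moved into the interval that
  $[-1,1]$ and the already clamped values leave for a 1-Lipschitz function.\<close>

fun lipschitz_clamp :: "(nat \<Rightarrow> nat \<Rightarrow> real) \<Rightarrow> (nat \<Rightarrow> real) \<Rightarrow> nat \<Rightarrow> real"
  where "lipschitz_clamp d s n =
    max (Max (insert (- 1) ((\<lambda>i. lipschitz_clamp d s i - d i n) ` {..<n})))
      (min (Min (insert 1 ((\<lambda>i. lipschitz_clamp d s i + d i n) ` {..<n}))) (s n))"

declare lipschitz_clamp.simps [simp del]

text \<open>The interval for coordinate \<open>n\<close> is nonempty: the earlier values are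
  1-Lipschitz, so the triangle inequality puts each lower bound below each upper bound.\<close>

lemma lipschitz_clamp_bounds:
  assumes sym: "\<And>i j. d i j = d j i" and tri: "\<And>i j k. d i k \<le> d i j + d j k"
    and nonneg: "\<And>i j. 0 \<le> d i j"
  shows "\<bar>lipschitz_clamp d s n\<bar> \<le> 1 \<and> (\<forall>i<n. \<bar>lipschitz_clamp d s i - lipschitz_clamp d s n\<bar> \<le> d i n)"
proof (induction n rule: less_induct)
  case (less n)
  define L where "L = lipschitz_clamp d s"
  define lo where "lo = Max (insert (- 1) ((\<lambda>i. L i - d i n) ` {..<n}))"
  define hi where "hi = Min (insert 1 ((\<lambda>i. L i + d i n) ` {..<n}))"
  have Ln: "L n = max lo (min hi (s n))"
    unfolding L_def lo_def hi_def by (rule lipschitz_clamp.simps)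
  have L1: "\<bar>L i\<bar> \<le> 1" if "i < n" for i
    using less that by (simp add: L_def)
  have L2: "L i - d i n \<le> L j + d j n" if "i < n" "j < n" for i j
  proof -
    have "\<bar>L i - L j\<bar> \<le> d i j"
    proof (cases i j rule: linorder_cases)
      case less
      then show ?thesis using less.IH[OF that(2)] by (auto simp: L_def)
    next
      case equal
      then show ?thesis using nonneg by simp
    next
      case greater
      then have "\<bar>L j - L i\<bar> \<le> d j i" using less.IH[OF that(1)] by (auto simp: L_def)
      then show ?thesis using sym[of i j] by linarith
    qed
    then show ?thesis using tri[of i j n] sym[of n j] by linarith
  qed
  have "lo \<le> hi"
  proof -
    have "- 1 \<le> L i + d i n" "L i - d i n \<le> 1" if "i < n" for i
      using L1[OF that] nonneg[of i n] by auto
    then show ?thesis unfolding lo_def hi_def using L2 by auto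
  qed
  then have "lo \<le> L n" "L n \<le> hi" unfolding Ln by auto
  moreover have "- 1 \<le> lo" "hi \<le> 1" and "\<And>i. i < n \<Longrightarrow> L i - d i n \<le> lo" "\<And>i. i < n \<Longrightarrow> hi \<le> L i + d i n"
    unfolding lo_def hi_def by (auto intro!: Max_ge Min_le)
  ultimately have "\<bar>L n\<bar> \<le> 1" and "\<And>i. i < n \<Longrightarrow> \<bar>L i - L n\<bar> \<le> d i n"
    by (force simp: abs_le_iff)+
  then show ?case by (simp add: L_def)
qed

lemma lipschitz_clamp_fixed:
  assumes "\<And>n. \<bar>f n\<bar> \<le> 1" "\<And>i j. \<bar>f i - f j\<bar> \<le> d i j"
  shows "lipschitz_clamp d f n = f n"
proof (induction n rule: less_induct)
  case (less n)
  have "- 1 \<le> f n" "f n \<le> 1" using assms(1)[of n] by auto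
  moreover have "f i - d i n \<le> f n" "f n \<le> f i + d i n" for i using assms(2)[of i n] by auto
  ultimately have "Max (insert (- 1) ((\<lambda>i. f i - d i n) ` {..<n})) \<le> f n"
      "f n \<le> Min (insert 1 ((\<lambda>i. f i + d i n) ` {..<n}))"
    by auto
  moreover have "lipschitz_clamp d f n = max (Max (insert (- 1) ((\<lambda>i. f i - d i n) ` {..<n})))
      (min (Min (insert 1 ((\<lambda>i. f i + d i n) ` {..<n}))) (f n))"
    by (subst lipschitz_clamp.simps) (simp add: less cong: image_cong_simp)
  ultimately show ?case by simp
qed

lemma continuous_on_Max_insert:
  fixes c :: real
  assumes "finite I" "\<And>i. i \<in> I \<Longrightarrow> continuous_on S (f i)"
  shows "continuous_on S (\<lambda>t. Max (insert c ((\<lambda>i. f i t) ` I)))"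
  using assms
proof (induction I)
  case (insert i I)
  have "insert c ((\<lambda>i. f i t) ` insert i I) = insert (f i t) (insert c ((\<lambda>i. f i t) ` I))" for t
    by auto
  then have "Max (insert c ((\<lambda>i. f i t) ` insert i I)) = max (f i t) (Max (insert c ((\<lambda>i. f i t) ` I)))" for t
    using insert.hyps by (simp only: Max_insert finite_insert finite_imageI insert_not_empty not_False_eq_True)
  with insert show ?case by (auto intro!: continuous_intros)
qed simp

lemma continuous_on_Min_insert:
  fixes c :: real
  assumes "finite I" "\<And>i. i \<in> I \<Longrightarrow> continuous_on S (f i)"
  shows "continuous_on S (\<lambda>t. Min (insert c ((\<lambda>i. f i t) ` I)))"
  using assms
proof (induction I)
  case (insert i I)
  have "insert c ((\<lambda>i. f i t) ` insert i I) = insert (f i t) (insert c ((\<lambda>i. f i t) ` I))" for t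
    by auto
  then have "Min (insert c ((\<lambda>i. f i t) ` insert i I)) = min (f i t) (Min (insert c ((\<lambda>i. f i t) ` I)))" for t
    using insert.hyps by (simp only: Min_insert finite_insert finite_imageI insert_not_empty not_False_eq_True)
  with insert show ?case by (auto intro!: continuous_intros)
qed simp

lemma continuous_on_lipschitz_clamp:
  assumes "\<And>n. continuous_on S (\<lambda>t. s t n)"
  shows "continuous_on S (\<lambda>t. lipschitz_clamp d (s t) n)"
proof (induction n rule: less_induct)
  case (less n)
  show ?case
    by (subst lipschitz_clamp.simps)
      (intro continuous_intros continuous_on_Max_insert continuous_on_Min_insert assms less; simp)
qed

text \<open>The point \<open>i\<close> is sent to the \<open>i\<close>-th coordinate of a curve that fills the compact set of all
  1-Lipschitz functions into $[-1,1]$, which is a retract of the cube by clamping.\<close>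

lemma countable_pseudometric_embedding:
  fixes d :: "nat \<Rightarrow> nat \<Rightarrow> real"
  assumes refl: "\<And>i. d i i = 0" and sym: "\<And>i j. d i j = d j i"
    and tri: "\<And>i j k. d i k \<le> d i j + d j k"
    and le2: "\<And>i j. d i j \<le> 2"
  shows "\<exists>F :: nat \<Rightarrow> C01. range F \<subseteq> sphere 0 1 \<and> (\<forall>i j. dist (F i) (F j) = d i j)"
proof -
  have nonneg: "0 \<le> d i j" for i j using tri[of i i j] refl[of i] sym[of i j] by linarith
  define s where "s t n = 2 * schoenberg n t - 1" for t n
  define L where "L i t = lipschitz_clamp d (s t) i" for i t
  have L1: "\<bar>L i t\<bar> \<le> 1" for i t
    using lipschitz_clamp_bounds[where d=d, OF sym tri nonneg] by (simp add: L_def)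
  have L2: "\<bar>L i t - L j t\<bar> \<le> d i j" for i j t
  proof -
    have *: "\<bar>L i t - L j t\<bar> \<le> d i j" if "i < j" for i j
      using lipschitz_clamp_bounds[where d=d, OF sym tri nonneg, where n=j] that by (simp add: L_def)
    show ?thesis
      using *[of i j] *[of j i] nonneg[of i j] sym[of i j]
      by (cases i j rule: linorder_cases) (auto simp: abs_minus_commute)
  qed
  have fill: "\<exists>t\<in>{0..1}. \<forall>i. L i t = f i"
    if "\<And>i. \<bar>f i\<bar> \<le> 1" "\<And>i j. \<bar>f i - f j\<bar> \<le> d i j" for f
  proof -
    have "(f n + 1) / 2 \<in> {0..1}" for n using that(1)[of n] by (auto simp: abs_le_iff)
    then have "\<exists>t\<in>{0..1}. \<forall>n. schoenberg n t = (f n + 1) / 2"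
      by (rule schoenberg_surjective)
    then obtain t where t: "t \<in> {0..1}" "\<And>n. schoenberg n t = (f n + 1) / 2" by blast
    have "s t = f" by (simp add: s_def fun_eq_iff t(2) field_simps)
    then have "L i t = f i" for i
      using lipschitz_clamp_fixed[where f=f and d=d, OF that] by (simp add: L_def)
    with t(1) show ?thesis by blast
  qed
  define F :: "nat \<Rightarrow> C01" where "F i = Bcontfun (\<lambda>x. L i (Rep_unit_interval x))" for i
  have F: "apply_bcontfun (F i) x = L i (Rep_unit_interval x)" for i x
  proof -
    have "continuous_on {0..1} (L i)"
      unfolding L_def s_def
      by (intro continuous_on_lipschitz_clamp continuous_intros continuous_on_schoenberg)
    then have "continuous_on {0..1} (\<lambda>t. L i (Rep_unit_interval (Abs_unit_interval t)))"
      by (rule continuous_on_eq) (simp add: Abs_unit_interval_inverse)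
    then have "(\<lambda>x. L i (Rep_unit_interval x)) \<in> bcontfun"
      by (simp add: bcontfun_unit_interval_iff continuous_on_unit_interval_iff)
    then show ?thesis unfolding F_def by (simp add: Bcontfun_inverse)
  qed
  have "F i \<in> sphere 0 1 \<and> dist (F i) (F j) = d i j" for i j
  proof
    \<comment> \<open>The curve passes through the constant function 1, so every \<open>F i\<close>
      attains the value 1.\<close>
    obtain t where t: "t \<in> {0..1}" "\<forall>i. L i t = 1"
      using fill[of "\<lambda>_. 1"] nonneg by auto
    have "norm (apply_bcontfun (F i) (Abs_unit_interval t)) = 1"
      using t by (simp add: F Abs_unit_interval_inverse)
    then have "1 \<le> norm (F i)" using norm_bounded[of "F i" "Abs_unit_interval t"] by simp
    moreover have "norm (F i) \<le> 1" using L1 by (intro norm_bound) (simp add: F)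
    ultimately show "F i \<in> sphere 0 1" by simp
    \<comment> \<open>The distance to \<open>j\<close>, lowered by 1, takes values in $[-1,1]$
      because \<open>d\<close> is at most 2; it separates \<open>i\<close> from \<open>j\<close> by
      exactly \<open>d i j\<close>.\<close>
    have "\<bar>(d k j - 1) - (d l j - 1)\<bar> \<le> d k l" for k l
      using tri[of k j l] tri[of l j k] sym[of k l] by auto
    moreover have "\<bar>d k j - 1\<bar> \<le> 1" for k using nonneg[of k j] le2[of k j] by auto
    ultimately obtain t where t: "t \<in> {0..1}" "\<forall>k. L k t = d k j - 1"
      using fill[of "\<lambda>k. d k j - 1"] by auto
    have "dist (apply_bcontfun (F i) (Abs_unit_interval t)) (apply_bcontfun (F j) (Abs_unit_interval t)) = d i j"
      using t nonneg by (simp add: F Abs_unit_interval_inverse dist_real_def refl)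
    then have "d i j \<le> dist (F i) (F j)" using dist_bounded by metis
    moreover have "dist (F i) (F j) \<le> d i j"
      using L2 by (intro dist_bound) (simp add: F dist_real_def)
    ultimately show "dist (F i) (F j) = d i j" by simp
  qed
  then show ?thesis by (intro exI[of _ F]) blast
qed

subsection \<open>The metric space of words\<close>

fun path_length :: "('a \<Rightarrow> 'a \<Rightarrow> real) \<Rightarrow> 'a \<Rightarrow> 'a list \<Rightarrow> 'a \<Rightarrow> real"
  where "path_length c a [] b = c a b"
  | "path_length c a (x # xs) b = c a x + path_length c x xs b"

text \<open>\<open>xs\<close> lists the intermediate stops. For a nonnegative cost this is the
  largest function below the cost that satisfies the triangle inequality.\<close>

definition path_dist :: "('a \<Rightarrow> 'a \<Rightarrow> real) \<Rightarrow> 'a \<Rightarrow> 'a \<Rightarrow> real"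
  where "path_dist c a b = (INF xs. path_length c a xs b)"

lemma path_length_append: "path_length c a (xs @ y # ys) b = path_length c a xs y + path_length c y ys b"
  by (induction xs arbitrary: a) auto

lemma path_length_rev:
  assumes "\<And>a b. c a b = c b a"
  shows "path_length c b (rev xs) a = path_length c a xs b"
  by (induction xs arbitrary: a) (auto simp: path_length_append assms)

lemma path_length_nonneg: "(\<And>a b. 0 \<le> c a b) \<Longrightarrow> 0 \<le> path_length c a xs b"
  by (induction xs arbitrary: a) auto

lemma path_dist_le: "(\<And>a b. 0 \<le> c a b) \<Longrightarrow> path_dist c a b \<le> path_length c a xs b"
  unfolding path_dist_def by (intro cINF_lower bdd_belowI2[of _ 0]) (auto intro: path_length_nonneg)

lemma path_dist_greatest: "(\<And>xs. z \<le> path_length c a xs b) \<Longrightarrow> z \<le> path_dist c a b"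
  unfolding path_dist_def by (rule cINF_greatest) auto

lemma path_dist_triangle:
  assumes "\<And>a b. 0 \<le> c a b"
  shows "path_dist c a b \<le> path_dist c a x + path_dist c x b"
proof -
  have "path_dist c a b - path_length c a xs x \<le> path_length c x ys b" for xs ys
    using path_dist_le[where c=c and a=a and b=b and xs="xs @ x # ys", OF assms] by (simp add: path_length_append)
  then have "path_dist c a b - path_dist c x b \<le> path_length c a xs x" for xs
    using path_dist_greatest[of "path_dist c a b - path_length c a xs x" c x b] by (auto simp: algebra_simps)
  then show ?thesis
    using path_dist_greatest[of "path_dist c a b - path_dist c x b" c a x] by (auto simp: algebra_simps)
qed

lemma path_dist_commute:
  assumes "\<And>a b. c a b = c b a"
  shows "path_dist c a b = path_dist c b a"
proof -
  have "range (\<lambda>xs. path_length c a xs b) = (\<lambda>xs. path_length c b xs a) ` range rev"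
    by (simp add: image_image path_length_rev[of c, OF assms])
  also have "range (rev :: 'a list \<Rightarrow> _) = UNIV" by (rule surjI[of _ rev]) (rule rev_rev_ident)
  finally show ?thesis by (simp add: path_dist_def)
qed

text \<open>A word \<open>a\<close> describes a point by its distances \<open>a ! j\<close> to earlier points; at index \<open>length a\<close>
  comes the distance 0 of the point to itself. The cost compares only the indices where both words
  have a letter, so it violates the triangle inequality through short words.\<close>

definition letter :: "real list \<Rightarrow> nat \<Rightarrow> real"
  where "letter a j = (if j < length a then a ! j else 0)"

text \<open>The range includes the length of the shorter word, so its final 0 is compared as
  well.\<close>

definition word_cost :: "real list \<Rightarrow> real list \<Rightarrow> real"
  where "word_cost a b = Max ((\<lambda>j. \<bar>letter a j - letter b j\<bar>) ` {..min (length a) (length b)})"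

lemma word_cost_ge: "j \<le> length a \<Longrightarrow> j \<le> length b \<Longrightarrow> \<bar>letter a j - letter b j\<bar> \<le> word_cost a b"
  unfolding word_cost_def by (intro Max_ge) auto

lemma word_cost_le_iff:
  "word_cost a b \<le> z \<longleftrightarrow> (\<forall>j\<le>min (length a) (length b). \<bar>letter a j - letter b j\<bar> \<le> z)"
  unfolding word_cost_def by (subst Max_le_iff) auto

lemma word_cost_nonneg: "0 \<le> word_cost a b"
  using word_cost_ge[of 0 a b] by linarith

lemma word_cost_commute: "word_cost a b = word_cost b a"
  by (simp add: word_cost_def abs_minus_commute min.commute)

lemma letter_bounds: "set a \<subseteq> {0..2} \<Longrightarrow> letter a j \<in> {0..2}"
  by (auto simp: letter_def dest: nth_mem)

text \<open>Along a path, the shortest word visited has letter 0 at an index where all other words of the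
  path have a letter, and this forces the length of the path.\<close>

lemma path_length_word_cost:
  assumes "\<And>i j. 0 \<le> letter (e i) j"
  shows "\<exists>l\<le>min (length (e i)) (length (e k)).
    letter (e i) l + letter (e k) l \<le> path_length (\<lambda>i k. word_cost (e i) (e k)) i xs k \<and>
    (\<forall>j\<le>l. \<bar>letter (e i) j - letter (e k) j\<bar> \<le> path_length (\<lambda>i k. word_cost (e i) (e k)) i xs k)"
proof (induction xs arbitrary: i)
  case Nil
  let ?l = "min (length (e i)) (length (e k))"
  \<comment> \<open>One of the two letters is the final 0 of the shorter word.\<close>
  have "letter (e i) ?l + letter (e k) ?l = \<bar>letter (e i) ?l - letter (e k) ?l\<bar>"
    using assms[of i ?l] assms[of k ?l] by (auto simp: letter_def min_def)
  then show ?case by (intro exI[of _ ?l]) (auto intro!: word_cost_ge)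
next
  case (Cons x xs)
  define p where "p = path_length (\<lambda>i k. word_cost (e i) (e k)) x xs k"
  obtain l where l: "l \<le> length (e x)" "l \<le> length (e k)" "letter (e x) l + letter (e k) l \<le> p"
    "\<And>j. j \<le> l \<Longrightarrow> \<bar>letter (e x) j - letter (e k) j\<bar> \<le> p"
    using Cons.IH[of x] unfolding p_def by auto
  \<comment> \<open>If \<open>e i\<close> is too short for \<open>l\<close>, the index drops to its
    end. Its letter there is 0, so the sum of letters equals their difference, which is already
    bounded.\<close>
  define l' where "l' = min l (length (e i))"
  have c: "\<bar>letter (e i) j - letter (e x) j\<bar> \<le> word_cost (e i) (e x)" if "j \<le> l'" for j
    using that l(1) by (intro word_cost_ge) (auto simp: l'_def)
  have "\<bar>letter (e i) j - letter (e k) j\<bar> \<le> word_cost (e i) (e x) + p" if "j \<le> l'" for j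
    using c[OF that] l(4)[of j] that by (auto simp: l'_def)
  moreover have "letter (e i) l' + letter (e k) l' \<le> word_cost (e i) (e x) + p"
  proof (cases "l \<le> length (e i)")
    case True
    then show ?thesis using c[of l'] l(3) by (auto simp: l'_def)
  next
    case False
    then have "letter (e i) l' = 0" "l' \<le> l" by (auto simp: l'_def letter_def)
    then show ?thesis using c[of l'] l(4)[of l'] by auto
  qed
  ultimately show ?case using l by (intro exI[of _ l']) (auto simp: l'_def p_def)
qed

text \<open>The points realise the path metric of the cost on an enumeration of the words. Every
  path is at least as long as some sum \<open>letter a l + letter b l\<close>, so if no such sum is
  below the cost, no detour is shorter than the direct step.\<close>

lemma word_embedding:
  assumes "countable \<Lambda>" "\<Lambda> \<subseteq> {0..2}"
  obtains \<psi> :: "real list \<Rightarrow> C01" where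
    "\<And>a. a \<in> lists \<Lambda> \<Longrightarrow> \<psi> a \<in> sphere 0 1"
    "\<And>a b. a \<in> lists \<Lambda> \<Longrightarrow> b \<in> lists \<Lambda> \<Longrightarrow> dist (\<psi> a) (\<psi> b) \<le> word_cost a b"
    "\<And>a b. a \<in> lists \<Lambda> \<Longrightarrow> b \<in> lists \<Lambda> \<Longrightarrow>
      (\<And>l. l \<le> min (length a) (length b) \<Longrightarrow> word_cost a b \<le> letter a l + letter b l) \<Longrightarrow>
      dist (\<psi> a) (\<psi> b) = word_cost a b"
proof -
  define e where "e = from_nat_into (lists \<Lambda>)"
  have cnt: "countable (lists \<Lambda>)" using assms(1) by (rule countable_lists)
  have ne: "lists \<Lambda> \<noteq> {}" by blast
  have set_e: "set (e i) \<subseteq> {0..2}" for i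
    using from_nat_into[OF ne, of i] assms(2) by (auto simp: e_def in_lists_conv_set)
  have letter_e: "0 \<le> letter (e i) j" "letter (e i) j \<le> 2" for i j
    using letter_bounds[OF set_e] by auto
  define c where "c = (\<lambda>i k. word_cost (e i) (e k))"
  have c0: "0 \<le> c i k" for i k by (simp add: c_def word_cost_nonneg)
  have c_sym: "c i k = c k i" for i k unfolding c_def by (rule word_cost_commute)
  have c2: "c i k \<le> 2" for i k
  proof -
    have "\<bar>letter (e i) j - letter (e k) j\<bar> \<le> 2" for j
      using letter_e[of i j] letter_e[of k j] by linarith
    then show ?thesis by (simp add: c_def word_cost_le_iff)
  qed
  have dist_le: "path_dist c i k \<le> c i k" for i k using path_dist_le[where c=c and a=i and b=k and xs="[]", OF c0] by simp
  have pos: "0 \<le> path_dist c i k" for i k by (intro path_dist_greatest path_length_nonneg c0)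
  have "path_dist c i i = 0" for i
  proof -
    have "c i i \<le> 0" unfolding c_def word_cost_le_iff by simp
    then show ?thesis using pos[of i i] dist_le[of i i] by linarith
  qed
  moreover have "path_dist c i j = path_dist c j i" for i j by (rule path_dist_commute) (rule c_sym)
  moreover have "path_dist c i k \<le> path_dist c i j + path_dist c j k" for i j k
    by (rule path_dist_triangle) (rule c0)
  moreover have "path_dist c i j \<le> 2" for i j using dist_le[of i j] c2[of i j] by linarith
  ultimately have "\<exists>F :: nat \<Rightarrow> C01. range F \<subseteq> sphere 0 1 \<and> (\<forall>i j. dist (F i) (F j) = path_dist c i j)"
    by (rule countable_pseudometric_embedding)
  then obtain F :: "nat \<Rightarrow> C01"
    where F: "\<And>i. F i \<in> sphere 0 1" "\<And>i j. dist (F i) (F j) = path_dist c i j"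
    by blast
  define \<psi> where "\<psi> a = F (to_nat_on (lists \<Lambda>) a)" for a
  have e_inv: "e (to_nat_on (lists \<Lambda>) a) = a" if "a \<in> lists \<Lambda>" for a
    using that cnt by (simp add: e_def)
  show thesis
  proof (rule that[of \<psi>])
    show le: "dist (\<psi> a) (\<psi> b) \<le> word_cost a b" if "a \<in> lists \<Lambda>" "b \<in> lists \<Lambda>" for a b
      using dist_le[of "to_nat_on (lists \<Lambda>) a" "to_nat_on (lists \<Lambda>) b"] that
      by (simp add: \<psi>_def F(2) c_def e_inv)
    show "dist (\<psi> a) (\<psi> b) = word_cost a b"
      if ab: "a \<in> lists \<Lambda>" "b \<in> lists \<Lambda>"
        and sum: "\<And>l. l \<le> min (length a) (length b) \<Longrightarrow> word_cost a b \<le> letter a l + letter b l" for a b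
    proof (rule antisym[OF le[OF ab]])
      let ?i = "to_nat_on (lists \<Lambda>) a" and ?k = "to_nat_on (lists \<Lambda>) b"
      have "word_cost a b \<le> path_length c ?i xs ?k" for xs
      proof -
        obtain l where "l \<le> min (length a) (length b)" "letter a l + letter b l \<le> path_length c ?i xs ?k"
          using path_length_word_cost[of e ?i ?k xs, OF letter_e(1)]
          unfolding c_def e_inv[OF ab(1)] e_inv[OF ab(2)] by blast
        with sum[of l] show ?thesis by linarith
      qed
      then show "word_cost a b \<le> dist (\<psi> a) (\<psi> b)"
        unfolding \<psi>_def F(2) by (rule path_dist_greatest)
    qed
  qed (use F(1) in \<open>simp add: \<psi>_def\<close>)
qed

subsection \<open>Separability and extension of isometries\<close>

text \<open>For each rational step function with \<open>n\<close> steps and each precision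
  \<open>1 / Suc k\<close>, one element of \<open>S\<close> that close to it is chosen, if there is
  any. This keeps \<open>D\<close> inside \<open>S\<close>.\<close>

lemma countable_dense_subset_C01:
  fixes S :: "C01 set"
  obtains D where "countable D" "D \<subseteq> S" "S \<subseteq> closure D"
proof -
  define P where "P = (\<lambda>(n, k, q) f. f \<in> S \<and>
    (\<forall>u. \<bar>apply_bcontfun f u - of_rat (q ! nat \<lfloor>real n * Rep_unit_interval u\<rfloor>)\<bar> \<le> 1 / real (Suc k)))"
    for p :: "nat \<times> nat \<times> rat list" and f
  define D where "D = (\<lambda>p. SOME f. P p f) ` {p. \<exists>f. P p f}"
  have D: "P p (SOME f. P p f)" if "P p f" for p f using that by (rule someI)
  show thesis
  proof (rule that)
    show "countable D" unfolding D_def by (intro countable_image countableI_type)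
    show "D \<subseteq> S"
    proof
      fix g assume "g \<in> D"
      then obtain p where "P p g" unfolding D_def using D by blast
      then show "g \<in> S" by (cases p) (simp add: P_def)
    qed
    show "S \<subseteq> closure D"
    proof
      fix f assume f: "f \<in> S"
      have "\<exists>y\<in>D. dist y f < e" if "0 < e" for e
      proof -
        obtain k where k: "2 / real (Suc k) < e"
          using reals_Archimedean[of "e / 2"] \<open>0 < e\<close> by (auto simp: field_simps)
        \<comment> \<open>Half of the precision goes to the oscillation of \<open>f\<close>, half to
          the rational approximation.\<close>
        define r where "r = 1 / (2 * real (Suc k))"
        have "0 < r" by (simp add: r_def)
        have "uniformly_continuous_on UNIV (apply_bcontfun f)"
          using compact_UNIV_unit_interval by (intro compact_uniformly_continuous) auto
        then obtain \<delta> where \<delta>: "0 < \<delta>" "\<And>u v. dist u v < \<delta> \<Longrightarrow> dist (apply_bcontfun f u) (apply_bcontfun f v) < r"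
          unfolding uniformly_continuous_on_def using \<open>0 < r\<close> by auto
        obtain n0 where "1 / real (Suc n0) < \<delta>"
          using reals_Archimedean[OF \<delta>(1)] by (auto simp: field_simps)
        then obtain n where n: "0 < n" "1 / real n < \<delta>" by blast
        have "\<exists>q::rat. \<bar>apply_bcontfun f (Abs_unit_interval (real i / real n)) - of_rat q\<bar> < r" for i
        proof -
          obtain q where "apply_bcontfun f (Abs_unit_interval (real i / real n)) - r < of_rat q"
            "of_rat q < apply_bcontfun f (Abs_unit_interval (real i / real n))"
            using of_rat_dense[of "apply_bcontfun f (Abs_unit_interval (real i / real n)) - r"
              "apply_bcontfun f (Abs_unit_interval (real i / real n))"] \<open>0 < r\<close> by auto
          then show ?thesis by (intro exI[of _ q]) auto
        qed
        then obtain Q :: "nat \<Rightarrow> rat" where Q: "\<And>i. \<bar>apply_bcontfun f (Abs_unit_interval (real i / real n)) - of_rat (Q i)\<bar> < r"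
          by metis
        \<comment> \<open>There are \<open>n + 1\<close> values, the last one for the right endpoint
          of the interval.\<close>
        define q where "q = map Q [0..<Suc n]"
        have "P (n, k, q) f"
        proof -
          have "\<bar>apply_bcontfun f u - of_rat (q ! nat \<lfloor>real n * Rep_unit_interval u\<rfloor>)\<bar> \<le> 1 / real (Suc k)" for u
          proof -
            define x where "x = Rep_unit_interval u"
            define i where "i = nat \<lfloor>real n * x\<rfloor>"
            have x: "0 \<le> x" "x \<le> 1" using Rep_unit_interval[of u] by (auto simp: x_def)
            have i: "real i \<le> real n * x" "real n * x < real i + 1"
              using x by (auto simp: i_def)
            have "real n * x \<le> real n" using x by (simp add: mult_left_le)
            then have "i \<le> n" using i(1) by linarith
            have "\<bar>x - real i / real n\<bar> \<le> 1 / real n"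
            proof -
              have "real i / real n \<le> x" "x \<le> (real i + 1) / real n"
                using i n(1) by (simp_all add: divide_le_eq le_divide_eq mult.commute)
              then show ?thesis by (simp add: add_divide_distrib abs_le_iff)
            qed
            moreover have "dist u (Abs_unit_interval (real i / real n)) = \<bar>x - real i / real n\<bar>"
              using \<open>i \<le> n\<close> n(1) by (simp add: dist_unit_interval_def x_def Abs_unit_interval_inverse)
            ultimately have "\<bar>apply_bcontfun f u - apply_bcontfun f (Abs_unit_interval (real i / real n))\<bar> < r"
              using \<delta>(2)[of u "Abs_unit_interval (real i / real n)"] n(2) by (simp add: dist_real_def)
            with Q[of i] have "\<bar>apply_bcontfun f u - of_rat (Q i)\<bar> \<le> 2 * r" by linarith
            moreover have "q ! i = Q i" using \<open>i \<le> n\<close> by (simp add: q_def del: upt_Suc)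
            moreover have "2 * r = 1 / real (Suc k)" by (simp add: r_def field_simps)
            ultimately show ?thesis unfolding i_def x_def by simp
          qed
          then show ?thesis using f by (simp add: P_def)
        qed
        define g where "g = (SOME g. P (n, k, q) g)"
        have g: "P (n, k, q) g" unfolding g_def by (rule D) fact
        have "g \<in> D" using \<open>P (n, k, q) f\<close> unfolding D_def g_def by blast
        have "\<bar>apply_bcontfun g u - apply_bcontfun f u\<bar> \<le> 2 / real (Suc k)" for u
        proof -
          let ?z = "of_rat (q ! nat \<lfloor>real n * Rep_unit_interval u\<rfloor>) :: real"
          have "\<bar>apply_bcontfun g u - ?z\<bar> \<le> 1 / real (Suc k)" "\<bar>apply_bcontfun f u - ?z\<bar> \<le> 1 / real (Suc k)"
            using g \<open>P (n, k, q) f\<close> by (auto simp: P_def)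
          moreover have "2 / real (Suc k) = 1 / real (Suc k) + 1 / real (Suc k)" by simp
          ultimately show ?thesis by linarith
        qed
        then have "dist g f \<le> 2 / real (Suc k)" by (intro dist_bound) (simp add: dist_real_def)
        then show ?thesis using \<open>g \<in> D\<close> k by (intro bexI[of _ g]) auto
      qed
      then show "f \<in> closure D" by (simp add: closure_approachable)
    qed
  qed
qed

text \<open>If \<open>x\<close> converges along indices, \<open>y\<close> is Cauchy along them, and
  distances pass to the limit. The last clause says in particular that the extension maps
  \<open>x n\<close> to \<open>y n\<close>.\<close>

lemma isometry_extends_to_closure:
  fixes x :: "nat \<Rightarrow> 'a::metric_space" and y :: "nat \<Rightarrow> 'b::complete_space"
  assumes iso: "\<And>i j. dist (y i) (y j) = dist (x i) (x j)"
  shows "\<exists>\<Phi>. \<forall>a\<in>closure (range x). \<Phi> a \<in> closure (range y) \<and>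
    (\<forall>b\<in>closure (range x). dist (\<Phi> a) (\<Phi> b) = dist a b) \<and> (\<forall>n. dist (\<Phi> a) (y n) = dist a (x n))"
proof -
  have ex: "\<exists>\<sigma>. (\<lambda>n. x (\<sigma> n)) \<longlonglongrightarrow> a \<and> convergent (\<lambda>n. y (\<sigma> n))" if a: "a \<in> closure (range x)" for a
  proof -
    obtain s where s: "\<And>n. s n \<in> range x" "s \<longlonglongrightarrow> a" using a unfolding closure_sequential by blast
    then have "\<forall>n. \<exists>k. s n = x k" by blast
    then obtain \<sigma> where \<sigma>: "\<And>n. s n = x (\<sigma> n)" by (rule choice[THEN exE]) blast
    have "Cauchy s" using s(2) by (rule LIMSEQ_imp_Cauchy)
    then have "Cauchy (\<lambda>n. y (\<sigma> n))" unfolding Cauchy_def \<sigma> iso .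
    then have "convergent (\<lambda>n. y (\<sigma> n))" by (rule Cauchy_convergent)
    moreover have "(\<lambda>n. x (\<sigma> n)) \<longlonglongrightarrow> a" using s(2) unfolding \<sigma> .
    ultimately show ?thesis by blast
  qed
  define \<sigma> where "\<sigma> a = (SOME \<sigma>. (\<lambda>n. x (\<sigma> n)) \<longlonglongrightarrow> a \<and> convergent (\<lambda>n. y (\<sigma> n)))" for a
  define \<Phi> where "\<Phi> a = lim (\<lambda>n. y (\<sigma> a n))" for a
  have X: "(\<lambda>n. x (\<sigma> a n)) \<longlonglongrightarrow> a" and Y: "(\<lambda>n. y (\<sigma> a n)) \<longlonglongrightarrow> \<Phi> a"
    if "a \<in> closure (range x)" for a
    using someI_ex[OF ex[OF that]] unfolding \<sigma>_def \<Phi>_def convergent_LIMSEQ_iff by auto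
  show ?thesis
  proof (intro exI[of _ \<Phi>] ballI conjI allI)
    show "\<Phi> a \<in> closure (range y)" if "a \<in> closure (range x)" for a
      unfolding closure_sequential using Y[OF that] by (intro exI[of _ "\<lambda>n. y (\<sigma> a n)"]) simp
    show "dist (\<Phi> a) (\<Phi> b) = dist a b" if "a \<in> closure (range x)" "b \<in> closure (range x)" for a b
    proof (rule LIMSEQ_unique)
      show "(\<lambda>n. dist (y (\<sigma> a n)) (y (\<sigma> b n))) \<longlonglongrightarrow> dist (\<Phi> a) (\<Phi> b)"
        by (intro tendsto_dist Y that)
      show "(\<lambda>n. dist (y (\<sigma> a n)) (y (\<sigma> b n))) \<longlonglongrightarrow> dist a b"
        unfolding iso by (intro tendsto_dist X that)
    qed
    show "dist (\<Phi> a) (y n) = dist a (x n)" if "a \<in> closure (range x)" for a n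
    proof (rule LIMSEQ_unique)
      show "(\<lambda>k. dist (y (\<sigma> a k)) (y n)) \<longlonglongrightarrow> dist (\<Phi> a) (y n)"
        by (intro tendsto_dist Y that tendsto_const)
      show "(\<lambda>k. dist (y (\<sigma> a k)) (y n)) \<longlonglongrightarrow> dist a (x n)"
        unfolding iso by (intro tendsto_dist X that tendsto_const)
    qed
  qed
qed

subsection \<open>Isometric copies near a colour class\<close>

text \<open>The last letter 0 of an integer word is the distance of the described point to itself, so it
  and all later letters are dropped.\<close>

definition cut :: "nat list \<Rightarrow> nat list"
  where "cut w = rev (tl (dropWhile (\<lambda>e. e \<noteq> 0) (rev w)))"

lemma cut_append: "0 \<notin> set h \<Longrightarrow> cut (p @ 0 # h) = p"
proof -
  assume "0 \<notin> set h"
  then have "dropWhile (\<lambda>e. e \<noteq> 0) (rev h @ 0 # rev p) = dropWhile (\<lambda>e. e \<noteq> 0) (0 # rev p)"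
    by (intro dropWhile_append2) (metis set_rev)
  then show ?thesis by (simp add: cut_def)
qed

lemma set_cut: "set (cut w) \<subseteq> set w"
proof -
  have tl: "set (tl xs) \<subseteq> set xs" for xs :: "nat list" by (cases xs) auto
  have "set (cut w) \<subseteq> set (dropWhile (\<lambda>e. e \<noteq> 0) (rev w))" unfolding cut_def set_rev by (rule tl)
  also have "\<dots> \<subseteq> set (rev w)" using set_dropWhileD by fast
  finally show ?thesis by simp
qed

lemma list_all2_concat_upt:
  "(\<And>k. k < l \<Longrightarrow> list_all2 R (F k) (G k)) \<Longrightarrow>
    list_all2 R (concat (map F [0..<l])) (concat (map G [0..<l]))"
  by (induction l) (auto intro: list_all2_appendI)

text \<open>The letter \<open>D\<close> meets the final 0 of \<open>b\<close>, so the cost is at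
  least \<open>D\<close>; the letterwise bounds give the converse and the condition under which
  \<open>word_embedding\<close> is exact.\<close>

lemma word_cost_prefix:
  assumes R: "list_all2 (\<lambda>x y. \<bar>x - y\<bar> \<le> D \<and> D \<le> x + y) p b" and "0 \<le> D"
  shows "word_cost (p @ D # r) b = D"
    and "l \<le> min (length (p @ D # r)) (length b) \<Longrightarrow> word_cost (p @ D # r) b \<le> letter (p @ D # r) l + letter b l"
proof -
  have len: "length p = length b" using R by (rule list_all2_lengthD)
  have *: "\<bar>letter (p @ D # r) j - letter b j\<bar> \<le> D \<and> D \<le> letter (p @ D # r) j + letter b j"
    if "j \<le> length b" for j
  proof (cases "j < length b")
    case True
    then show ?thesis using list_all2_nthD[OF R, of j] len by (simp add: letter_def nth_append)
  next
    case False
    then show ?thesis using that len \<open>0 \<le> D\<close> by (simp add: letter_def nth_append)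
  qed
  have "D = \<bar>letter (p @ D # r) (length b) - letter b (length b)\<bar>"
    using len \<open>0 \<le> D\<close> by (simp add: letter_def nth_append)
  also have "\<dots> \<le> word_cost (p @ D # r) b" using len by (intro word_cost_ge) auto
  finally have "D \<le> word_cost (p @ D # r) b" .
  moreover have "word_cost (p @ D # r) b \<le> D" using * by (simp add: word_cost_le_iff)
  ultimately show cost: "word_cost (p @ D # r) b = D" by simp
  show "word_cost (p @ D # r) b \<le> letter (p @ D # r) l + letter b l"
    if "l \<le> min (length (p @ D # r)) (length b)"
    using * that unfolding cost by simp
qed

lemma word_cost_list_all2:
  assumes R: "list_all2 (\<lambda>x y. \<bar>x - y\<bar> \<le> D) a b" and "0 \<le> D"
  shows "word_cost a b \<le> D"
proof -
  have len: "length a = length b" using R by (rule list_all2_lengthD)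
  have "\<bar>letter a j - letter b j\<bar> \<le> D" for j
    using list_all2_nthD[OF R, of j] len \<open>0 \<le> D\<close> by (simp add: letter_def)
  then show ?thesis by (simp add: word_cost_le_iff)
qed

lemma isometric_copy_near_colour:
  fixes c :: "C01 \<Rightarrow> nat" and d :: "nat \<Rightarrow> nat \<Rightarrow> real"
  assumes "0 < \<epsilon>" and c: "\<And>f. f \<in> sphere 0 1 \<Longrightarrow> c f < k"
    and sym: "\<And>i j. d i j = d j i" and refl: "\<And>i. d i i = 0"
    and tri: "\<And>i j k. d i k \<le> d i j + d j k" and le2: "\<And>i j. d i j \<le> 2"
  shows "\<exists>i<k. \<exists>y. (\<forall>n. y n \<in> sphere 0 1) \<and> (\<forall>n l. dist (y n) (y l) = d n l) \<and>
    (\<forall>n. \<exists>z\<in>sphere 0 1. c z = i \<and> dist (y n) z \<le> \<epsilon>)"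
proof -
  have nonneg: "0 \<le> d i j" for i j using tri[of i i j] refl[of i] sym[of i j] by linarith
  obtain m0 where m0: "1 / real (Suc m0) < \<epsilon> / 2"
    using reals_Archimedean[of "\<epsilon> / 2"] \<open>0 < \<epsilon>\<close> by (auto simp: field_simps)
  define m where "m = Suc m0"
  define \<eta> where "\<eta> = 2 / real m"
  have \<eta>: "0 < \<eta>" "\<eta> \<le> \<epsilon>" "\<eta> * real m = 2" using m0 by (simp_all add: \<eta>_def m_def field_simps)
  define grid where "grid e = \<eta> * real e" for e :: nat
  have grid: "0 \<le> grid e" "e \<le> m \<Longrightarrow> grid e \<le> 2" for e
    using \<eta> mult_left_mono[of "real e" "real m" \<eta>] by (auto simp: grid_def)
  \<comment> \<open>The letters are the grid values and their translates by exact distances, cut off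
    at 2.\<close>
  define \<Lambda> where "\<Lambda> = grid ` {..m} \<union> (\<lambda>(e, n, l). min 2 (grid e + d n l)) ` UNIV"
  have "countable \<Lambda>" unfolding \<Lambda>_def by (intro countable_Un countable_image countableI_type)
  moreover have "\<Lambda> \<subseteq> {0..2}" unfolding \<Lambda>_def using grid nonneg by auto
  ultimately obtain \<psi> :: "real list \<Rightarrow> C01" where
    \<psi>1: "\<And>a. a \<in> lists \<Lambda> \<Longrightarrow> \<psi> a \<in> sphere 0 1" and
    \<psi>2: "\<And>a b. a \<in> lists \<Lambda> \<Longrightarrow> b \<in> lists \<Lambda> \<Longrightarrow> dist (\<psi> a) (\<psi> b) \<le> word_cost a b" and
    \<psi>3: "\<And>a b. a \<in> lists \<Lambda> \<Longrightarrow> b \<in> lists \<Lambda> \<Longrightarrow>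
      (\<And>l. l \<le> min (length a) (length b) \<Longrightarrow> word_cost a b \<le> letter a l + letter b l) \<Longrightarrow>
      dist (\<psi> a) (\<psi> b) = word_cost a b"
    by (rule word_embedding) blast
  have grid_lists: "map grid w \<in> lists \<Lambda>" if "set w \<subseteq> {..m}" for w
    unfolding in_lists_conv_set set_map using image_mono[OF that, of grid] unfolding \<Lambda>_def by blast
  have rank0: "set w \<subseteq> {..m}" if "w \<in> rank_words m 0" for w using that by (auto simp: rank_words_def)
  have "c (\<psi> (map grid (cut w))) < k" if "w \<in> rank_words m 0" for w
    using rank0[OF that] set_cut[of w] by (intro c \<psi>1 grid_lists) auto
  then have "\<exists>i<k. \<exists>b. (\<forall>n. b n \<in> rank_words m 0) \<and> (\<forall>n j. (\<forall>l<n. j l \<le> m) \<longrightarrow>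
      c (\<psi> (map grid (cut (concat (map (\<lambda>l. raise m (j l) (b l)) [0..<n]) @ b n)))) = i)"
    by (rule raised_concat_monochromatic)
  then obtain i b where i: "i < k" and b: "\<And>n. b n \<in> rank_words m 0"
    and mono: "\<And>n j. \<forall>l<n. j l \<le> m \<Longrightarrow>
      c (\<psi> (map grid (cut (concat (map (\<lambda>l. raise m (j l) (b l)) [0..<n]) @ b n)))) = i"
    by blast
  have "\<exists>g h. b n = g @ 0 # h \<and> 0 \<notin> set h" for n
    using b[of n] by (intro split_list_last) (simp add: rank_words_def)
  \<comment> \<open>Cutting leaves only \<open>g n\<close> of a final block. Later words contain the
    whole raised block, where the 0 after \<open>g n\<close> turns into a distance.\<close>
  then obtain g h where gh: "\<And>n. b n = g n @ 0 # h n" "\<And>n. 0 \<notin> set (h n)" by metis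
  have set_b: "e \<le> m" if "e \<in> set (b n)" for e n using rank0[OF b[of n]] that by auto
  have set_g: "e \<le> m" if "e \<in> set (g n)" for e n using set_b[of e n] that by (simp add: gh(1))
  define shift where "shift t w = map (\<lambda>e. min 2 (grid e + t)) w" for t and w :: "nat list"
  define J where "J n l = nat \<lceil>d n l / \<eta>\<rceil>" for n l
  have J: "d n l \<le> grid (J n l)" "grid (J n l) \<le> d n l + \<eta>" "J n l \<le> m" for n l
  proof -
    have "real (J n l) = of_int \<lceil>d n l / \<eta>\<rceil>" using nonneg[of n l] \<eta>(1) by (simp add: J_def)
    then have J': "d n l / \<eta> \<le> real (J n l)" "real (J n l) \<le> d n l / \<eta> + 1" by linarith+
    from J'(1) show "d n l \<le> grid (J n l)" using \<eta>(1) by (simp add: grid_def field_simps)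
    from J'(2) show "grid (J n l) \<le> d n l + \<eta>" using \<eta>(1) by (simp add: grid_def field_simps)
    have "d n l / \<eta> \<le> real m" using \<eta> le2[of n l] by (simp add: field_simps)
    then show "J n l \<le> m" by (simp add: J_def ceiling_le_iff)
  qed
  \<comment> \<open>\<open>a n\<close> is the grid word of colour \<open>i\<close>;
    \<open>u n\<close> has exact distances in place of those rounded up by \<open>J\<close>.\<close>
  define a where "a n = concat (map (\<lambda>l. raise m (J n l) (b l)) [0..<n]) @ g n" for n
  define u where "u n = concat (map (\<lambda>l. shift (d n l) (b l)) [0..<n]) @ map grid (g n)" for n
  have col: "c (\<psi> (map grid (a n))) = i" for n
    using mono[of n "J n"] J(3) cut_append[OF gh(2)[of n], of "a n"]
    by (simp add: a_def gh(1)[of n])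
  have a_\<Lambda>: "map grid (a n) \<in> lists \<Lambda>" for n
    by (rule grid_lists) (auto simp: a_def raise_def dest: set_g)
  have u_\<Lambda>: "u n \<in> lists \<Lambda>" for n
  proof -
    have "grid ` set (g n) \<subseteq> \<Lambda>" using set_g[of _ n] by (auto simp: \<Lambda>_def)
    moreover have "y \<in> \<Lambda>" if "y \<in> set (shift (d n l) w)" for y l w
    proof -
      have "min 2 (grid e + d n l) \<in> \<Lambda>" for e
        unfolding \<Lambda>_def by (rule UnI2, rule image_eqI[of _ _ "(e, n, l)"]) simp_all
      then show ?thesis using that by (auto simp: shift_def)
    qed
    ultimately show ?thesis unfolding u_def in_lists_conv_set by auto
  qed
  have "dist (\<psi> (u n)) (\<psi> (map grid (a n))) \<le> \<eta>" for n
  proof (rule order_trans[OF \<psi>2[OF u_\<Lambda> a_\<Lambda>] word_cost_list_all2])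
    have blk: "list_all2 (\<lambda>x y. \<bar>x - y\<bar> \<le> \<eta>) (shift (d n l) (b l)) (map grid (raise m (J n l) (b l)))" for l
    proof -
      have "\<bar>min 2 (grid e + d n l) - grid (min (e + J n l) m)\<bar> \<le> \<eta>" for e
      proof -
        have add: "grid (e + J n l) = grid e + grid (J n l)" by (simp add: grid_def distrib_left)
        \<comment> \<open>Cutting off at \<open>m\<close> steps is cutting off at 2, which does not
          increase the rounding error.\<close>
        have "grid (min (e + J n l) m) = min (grid e + grid (J n l)) 2"
        proof (cases "e + J n l \<le> m")
          case True
          then show ?thesis using grid(2)[OF True] add by simp
        next
          case False
          then have "\<eta> * real m \<le> \<eta> * real (e + J n l)" using \<eta>(1) by (intro mult_left_mono) auto
          then have "2 \<le> grid (e + J n l)" by (simp only: \<eta>(3) grid_def)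
          then have "2 \<le> grid e + grid (J n l)" by (simp only: add)
          then show ?thesis using False \<eta>(3) by (simp add: grid_def)
        qed
        then show ?thesis using J(1,2)[of n l] by linarith
      qed
      then show ?thesis by (simp add: shift_def raise_def list_all2_map1 list_all2_map2 list_all2_same)
    qed
    have "list_all2 (\<lambda>x y. \<bar>x - y\<bar> \<le> \<eta>) (map grid (g n)) (map grid (g n))"
      using \<eta>(1) by (simp add: list_all2_same)
    then show "list_all2 (\<lambda>x y. \<bar>x - y\<bar> \<le> \<eta>) (u n) (map grid (a n))"
      unfolding u_def a_def map_append map_concat map_map comp_def
      by (intro list_all2_appendI list_all2_concat_upt blk)
  qed (use \<eta> in simp)
  moreover have "dist (\<psi> (u n)) (\<psi> (u l)) = d n l" for n l
  proof -
    have *: "dist (\<psi> (u n)) (\<psi> (u l)) = d n l" if "l < n" for n l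
    proof -
      \<comment> \<open>\<open>p\<close> is the part of \<open>u n\<close> before the image
        \<open>d n l\<close> of the last 0 of \<open>b l\<close>. It is as long as
        \<open>u l\<close>, since shifting keeps block lengths.\<close>
      define p where "p = concat (map (\<lambda>k. shift (d n k) (b k)) [0..<l]) @ shift (d n l) (g l)"
      have "[0..<n] = [0..<l] @ l # [Suc l..<n]"
        using that by (metis le_add_diff_inverse less_imp_le_nat upt_add_eq_append upt_rec zero_le)
      then obtain r where u_n: "u n = p @ d n l # r"
        using nonneg[of n l] le2[of n l]
        by (simp add: u_def p_def gh(1)[of l] shift_def grid_def)
      let ?R = "\<lambda>x y. \<bar>x - y\<bar> \<le> d n l \<and> d n l \<le> x + y"
      have "list_all2 ?R (shift (d n k) (b k)) (shift (d l k) (b k))" for k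
      proof -
        \<comment> \<open>Corresponding letters are one grid value shifted by \<open>d n k\<close>
          and \<open>d l k\<close>. The triangle inequalities bound their difference and sum, and
          survive the cut-off at 2 because \<open>d n l \<le> 2\<close>.\<close>
        have "\<bar>d n k - d l k\<bar> \<le> d n l" "d n l \<le> d n k + d l k"
          using tri[of n k l] tri[of l k n] tri[of n l k] sym[of n l] sym[of l k] by linarith+
        then have "?R (min 2 (grid e + d n k)) (min 2 (grid e + d l k))" for e
          using grid(1)[of e] le2[of n l] nonneg[of n k] nonneg[of l k] by linarith
        then show ?thesis by (simp add: shift_def list_all2_map1 list_all2_map2 list_all2_same)
      qed
      moreover have "list_all2 ?R (shift (d n l) (g l)) (map grid (g l))"
      proof -
        have "?R (min 2 (grid e + d n l)) (grid e)" if "e \<le> m" for e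
          using grid[of e] that le2[of n l] nonneg[of n l] by linarith
        then show ?thesis using set_g by (simp add: shift_def list_all2_map1 list_all2_map2 list_all2_same)
      qed
      ultimately have R: "list_all2 ?R p (u l)"
        unfolding p_def u_def by (intro list_all2_appendI list_all2_concat_upt)
      have "dist (\<psi> (u n)) (\<psi> (u l)) = word_cost (u n) (u l)"
        unfolding u_n using word_cost_prefix(2)[OF R nonneg] u_\<Lambda>[of n] u_\<Lambda>[of l]
        by (intro \<psi>3) (simp_all add: u_n)
      also have "\<dots> = d n l" unfolding u_n by (rule word_cost_prefix(1)[OF R nonneg])
      finally show ?thesis .
    qed
    show ?thesis
      using *[of l n] *[of n l] refl[of n] sym[of n l]
      by (cases n l rule: linorder_cases) (simp_all add: dist_commute)
  qed
  ultimately show ?thesis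
    using i \<psi>1[OF u_\<Lambda>] \<psi>1[OF a_\<Lambda>] col \<eta>(2)
    by (intro exI[of _ i] conjI exI[of _ "\<lambda>n. \<psi> (u n)"] allI)
      (auto intro!: bexI[of _ "\<psi> (map grid (a _))"] order_trans[OF _ \<eta>(2)])
qed

section \<open>From a dense sequence to the whole sphere\<close>

theorem theorem74:
  shows "approx_indivisible (sphere (0::C01) 1)"
  unfolding approx_indivisible_def eps_indivisible_def
proof (intro allI impI ballI)
  fix \<epsilon> :: real and k :: nat and c :: "C01 \<Rightarrow> nat"
  define S where "S = sphere (0::C01) 1"
  assume "0 < \<epsilon>" and "c \<in> sphere 0 1 \<rightarrow> {..<k}"
  then have c: "c f < k" if "f \<in> S" for f using that by (auto simp: S_def)
  obtain D where D: "countable D" "D \<subseteq> S" "S \<subseteq> closure D" by (rule countable_dense_subset_C01)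
  \<comment> \<open>Embedding the zero pseudometric shows that the sphere is nonempty.\<close>
  obtain F :: "nat \<Rightarrow> C01" where "range F \<subseteq> S"
    using countable_pseudometric_embedding[of "\<lambda>_ _. 0"] unfolding S_def by auto
  then have "D \<noteq> {}" using D(3) by auto
  define x where "x = from_nat_into D"
  have range_x: "range x = D" unfolding x_def by (rule range_from_nat_into[OF \<open>D \<noteq> {}\<close> D(1)])
  have "dist (x i) (x j) \<le> 2" for i j
  proof -
    have "x n \<in> S" for n using D(2) range_x by blast
    then have "norm (x i) = 1" "norm (x j) = 1" by (simp_all add: S_def)
    then show ?thesis using norm_triangle_ineq4[of "x i" "x j"] by (simp add: dist_norm)
  qed
  note le2 = this
  \<comment> \<open>The other half of \<open>\<epsilon>\<close> is spent on approximating points of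
    the sphere by the sequence \<open>x\<close>.\<close>
  have "\<exists>i<k. \<exists>y. (\<forall>n. y n \<in> sphere 0 1) \<and> (\<forall>n l. dist (y n) (y l) = dist (x n) (x l)) \<and>
    (\<forall>n. \<exists>z\<in>sphere 0 1. c z = i \<and> dist (y n) z \<le> \<epsilon> / 2)"
  proof (rule isometric_copy_near_colour)
    show "0 < \<epsilon> / 2" using \<open>0 < \<epsilon>\<close> by simp
    show "c f < k" if "f \<in> sphere 0 1" for f using c that by (simp add: S_def)
    show "dist (x i) (x j) = dist (x j) (x i)" for i j by (rule dist_commute)
    show "dist (x i) (x l) \<le> dist (x i) (x j) + dist (x j) (x l)" for i j l by (rule dist_triangle)
  qed (simp_all only: dist_self le2)
  then obtain i y where i: "i < k" and y: "\<And>n. y n \<in> S" "\<And>n l. dist (y n) (y l) = dist (x n) (x l)"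
    and near: "\<And>n. \<exists>z\<in>S. c z = i \<and> dist (y n) z \<le> \<epsilon> / 2"
    unfolding S_def by blast
  obtain \<Phi> where "\<forall>a\<in>closure (range x). \<Phi> a \<in> closure (range y) \<and>
    (\<forall>b\<in>closure (range x). dist (\<Phi> a) (\<Phi> b) = dist a b) \<and> (\<forall>n. dist (\<Phi> a) (y n) = dist a (x n))"
    using isometry_extends_to_closure[where x=x and y=y, OF y(2)] by (rule exE)
  then have \<Phi>: "\<And>a. a \<in> closure (range x) \<Longrightarrow> \<Phi> a \<in> closure (range y)"
    "\<And>a b. a \<in> closure (range x) \<Longrightarrow> b \<in> closure (range x) \<Longrightarrow> dist (\<Phi> a) (\<Phi> b) = dist a b"
    "\<And>a n. a \<in> closure (range x) \<Longrightarrow> dist (\<Phi> a) (y n) = dist a (x n)"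
    by blast+
  have SD: "a \<in> closure (range x)" if "a \<in> S" for a using D(3) that range_x by auto
  have "closed {f :: C01. norm f = 1}" by (intro closed_Collect_eq continuous_intros)
  also have "{f :: C01. norm f = 1} = S" by (auto simp: S_def)
  finally have "closure (range y) \<subseteq> S" using y(1) by (intro closure_minimal) auto
  then have \<Phi>S: "\<Phi> a \<in> S" if "a \<in> S" for a using \<Phi>(1)[OF SD[OF that]] by blast
  have inj: "inj_on \<Phi> S"
  proof (rule inj_onI)
    fix a b assume "a \<in> S" "b \<in> S" "\<Phi> a = \<Phi> b"
    then show "a = b" using \<Phi>(2)[OF SD SD, of a b] by simp
  qed
  have "isometric (\<Phi> ` S) S"
    unfolding isometric_def
  proof (intro exI conjI ballI)
    \<comment> \<open>The required isometry goes from the copy to the sphere, so it is the inverse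
      of \<open>\<Phi>\<close>.\<close>
    show "bij_betw (inv_into S \<Phi>) (\<Phi> ` S) S" using inj by (intro bij_betw_inv_into) (simp add: bij_betw_def)
    fix f g assume "f \<in> \<Phi> ` S" "g \<in> \<Phi> ` S"
    then show "dist (inv_into S \<Phi> f) (inv_into S \<Phi> g) = dist f g"
      using \<Phi>(2) SD inj by auto
  qed
  moreover have "\<Phi> ` S \<subseteq> closed_fattening S {f \<in> S. c f = i} \<epsilon>"
  proof
    fix f assume "f \<in> \<Phi> ` S"
    then obtain a where a: "a \<in> S" "f = \<Phi> a" by blast
    obtain n where n: "dist (x n) a < \<epsilon> / 2"
      using SD[OF a(1)] \<open>0 < \<epsilon>\<close> unfolding closure_approachable by (auto dest: spec[of _ "\<epsilon> / 2"])
    obtain z where z: "z \<in> S" "c z = i" "dist (y n) z \<le> \<epsilon> / 2" using near by blast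
    have "dist f z \<le> dist f (y n) + dist (y n) z" by (rule dist_triangle)
    also have "\<dots> \<le> \<epsilon>" using \<Phi>(3)[OF SD[OF a(1)], of n] n z(3) by (simp add: a(2) dist_commute)
    finally show "f \<in> closed_fattening S {f \<in> S. c f = i} \<epsilon>"
      using z \<Phi>S[OF a(1)] unfolding closed_fattening_def a(2) by blast
  qed
  ultimately show "\<exists>i<k. \<exists>X'\<subseteq>sphere 0 1. isometric X' (sphere (0::C01) 1) \<and>
      X' \<subseteq> closed_fattening (sphere 0 1) {f \<in> sphere 0 1. c f = i} \<epsilon>"
    using i \<Phi>S unfolding S_def[symmetric] by (intro exI[of _ i] conjI exI[of _ "\<Phi> ` S"]) auto
qed

end
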